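(* Let $\sigma>0$ and suppose that $\sigma xf'-\sigma f+\frac12f^2=\frac12Ax^2+Bx+C$ with $A>0$. Then the PDE $$u_t=\sigma xu_{xx}+f(x)u_x-\frac{\mu}{x}u,\qquad\mu\ge0,$$ has a fundamental solution of the form $$p(t,x,y)=\frac{\sqrt A\,e^{(F(y)-F(x))/(2\sigma)}}{2\sigma\sinh(\sqrt At/2)}\sqrt{\frac xy}\exp\left\{-\frac{Bt}{2\sigma}-\frac{\sqrt A(x+y)}{2\sigma\tanh(\sqrt At/2)}\right\}\left(C_1(y)I_\nu\left(\frac{\sqrt{Axy}}{\sigma\sinh(\sqrt At/2)}\right)+C_2(y)I_{-\nu}\left(\frac{\sqrt{Axy}}{\sigma\sinh(\sqrt At/2)}\right)\right)$$ for some functions $C_1(y),C_2(y)$, in which $F'(x)=f(x)/x$ and $\nu=\frac{\sqrt{2C+4\mu\sigma+\sigma^2}}{\sigma}$, and $I_{-\nu}(z)$ is interpreted as $K_\nu(z)$ if $\nu$ is an integer.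
   Context: The PDE is considered for $x\ge 0$, $t>0$. $I_\nu,K_\nu$ are the modified Bessel functions of the first and second kind. A fundamental solution of the PDE is a kernel $p(t,x,y)$, $t>0$, $x,y\ge 0$, such that for suitable initial data $\varphi$ (e.g. continuous with compact support in $(0,\infty)$) the function $u(x,t)=\int_0^\infty\varphi(y)p(t,x,y)\,dy$ solves the PDE for $t>0$ and satisfies $u(x,0)=\varphi(x)$. Fundamental solutions need not be unique. *)

theory Defs
  imports "HOL-Analysis.Analysis"
begin

text \<open>Modified Bessel functions of real order at a positive real argument.  The reciprocal Gamma
  function vanishes at the poles of Gamma, so the power series of the first kind is meaningful for
  every real order; at integer order the second kind is the limit in the order.\<close>

definition bessel_I :: "real \<Rightarrow> real \<Rightarrow> real" where
  "bessel_I \<nu> z = (\<Sum>m. (z / 2) powr (2 * real m + \<nu>) * rGamma (real m + \<nu> + 1) / fact m)"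

definition bessel_K :: "real \<Rightarrow> real \<Rightarrow> real" where
  "bessel_K \<nu> z =
     (let K = (\<lambda>\<eta>. pi / 2 * (bessel_I (- \<eta>) z - bessel_I \<eta> z) / sin (\<eta> * pi))
      in if \<nu> \<in> \<int> then Lim (at \<nu>) K else K \<nu>)"

text \<open>The second solution, \<open>I\<^bsub>-\<nu>\<^esub>\<close>, read as \<open>K\<^bsub>\<nu>\<^esub>\<close> at integer order.\<close>

definition bessel_I_minus :: "real \<Rightarrow> real \<Rightarrow> real" where
  "bessel_I_minus \<nu> z = (if \<nu> \<in> \<int> then bessel_K \<nu> z else bessel_I (- \<nu>) z)"

text \<open>Classical solutions \<open>u t x\<close> of \<open>u\<^sub>t = \<sigma> x u\<^sub>x\<^sub>x + f(x) u\<^sub>x - (\<mu>/x) u\<close>.  The equation is imposed at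
  \<open>x > 0\<close>; at \<open>x = 0\<close> its coefficients are in general undefined.\<close>

definition solves_pde ::
    "real \<Rightarrow> (real \<Rightarrow> real) \<Rightarrow> real \<Rightarrow> (real \<Rightarrow> real \<Rightarrow> real) \<Rightarrow> bool" where
  "solves_pde \<sigma> f \<mu> u \<longleftrightarrow>
     (\<forall>t>0. \<forall>x>0.
        (\<lambda>s. u s x) differentiable at t \<and>
        u t differentiable at x \<and>
        deriv (u t) differentiable at x \<and>
        deriv (\<lambda>s. u s x) t
          = \<sigma> * x * deriv (deriv (u t)) x + f x * deriv (u t) x - \<mu> / x * u t x)"

definition initial_datum :: "(real \<Rightarrow> real) \<Rightarrow> bool" where
  "initial_datum \<phi> \<longleftrightarrow>
     continuous_on UNIV \<phi> \<and>
     compact (closure {y. \<phi> y \<noteq> 0}) \<and> closure {y. \<phi> y \<noteq> 0} \<subseteq> {0<..}"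

text \<open>The Lebesgue integral is 0 for a non-integrable integrand, so integrability is required
  explicitly.  The initial condition \<open>u(x,0) = \<phi>(x)\<close> is that of the Cauchy problem: \<open>u\<close>, extended by
  \<open>\<phi>\<close>, is continuous up to \<open>t = 0\<close>.\<close>

definition fundamental_solution ::
    "real \<Rightarrow> (real \<Rightarrow> real) \<Rightarrow> real \<Rightarrow> (real \<Rightarrow> real \<Rightarrow> real \<Rightarrow> real) \<Rightarrow> bool" where
  "fundamental_solution \<sigma> f \<mu> p \<longleftrightarrow>
     (\<forall>\<phi>. initial_datum \<phi> \<longrightarrow>
        (\<forall>t>0. \<forall>x>0. set_integrable lborel {0..} (\<lambda>y. \<phi> y * p t x y)) \<and>
        (let u = (\<lambda>t x. LINT y:{0..}|lborel. \<phi> y * p t x y) in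
           solves_pde \<sigma> f \<mu> u \<and>
           (\<forall>x>0. ((\<lambda>(t, \<xi>). u t \<xi>) \<longlongrightarrow> \<phi> x) (at (0, x) within {0<..} \<times> {0<..}))))"

end

theory Submission
  imports Defs
begin

text \<open>The choice \<open>C1 = 1, C2 = 0\<close> works.  Put \<open>a = sqrt A / (2\<sigma>)\<close>, \<open>c(t) = a coth (\<sigma>at)\<close>,
  \<open>r(t) = a / sinh (\<sigma>at)\<close> and \<open>I\<^bsub>\<nu>\<^esub>(z) = (z/2)\<^bsup>\<nu>\<^esup> E(z\<^sup>2/4)\<close> with \<open>E\<close> entire.  The kernel becomes
  \<open>exp ((F y - F x - Bt) / (2\<sigma>)) r\<^bsup>\<nu>+1\<^esup> x\<^bsup>(\<nu>+1)/2\<^esup> y\<^bsup>(\<nu>-1)/2\<^esup> exp (-c(x+y)) E(r\<^sup>2xy)\<close>,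
  so \<open>u\<close> is an elementary factor times an integral over the compact support of the datum, which may be
  differentiated under the integral sign; the equation then reduces to \<open>s E'' + (\<nu>+1) E' = E\<close>,
  \<open>c\<^sup>2 = a\<^sup>2 + r\<^sup>2\<close> and the Riccati equation for \<open>f\<close>.

  The initial condition needs no asymptotics of \<open>I\<^bsub>\<nu>\<^esub>\<close>.  Termwise integration gives
  \<open>\<integral> y\<^bsup>\<nu>\<^esup> exp (-py) E(qy) dy = p\<^bsup>-\<nu>-1\<^esup> exp (q/p)\<close> over \<open>y > 0\<close>, so the Laplace transform in \<open>y\<close> of the
  kernel weighted with \<open>y\<^bsup>(\<nu>+1)/2\<^esup>\<close> is explicit and converges, as \<open>t\<close> tends to 0, to that of a point mass.
  Since the kernel is nonnegative, a Korovkin argument finishes the proof.\<close>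

section \<open>The entire part of the Bessel function of the first kind\<close>

text \<open>Up to the factor \<open>rGamma (\<nu> + 1)\<close> this is the hypergeometric function
  0F1(; \<nu> + 1; s). It is the function E of the overview; the fractional power is split off so
  that the rest is entire and can be differentiated termwise.\<close>

definition bessel_series :: "real \<Rightarrow> real \<Rightarrow> real" where
  "bessel_series \<nu> s = (\<Sum>m. rGamma (real m + \<nu> + 1) / fact m * s ^ m)"

lemma rGamma_pos_real: "x > 0 \<Longrightarrow> rGamma x > (0::real)"
  by (simp add: rGamma_inverse_Gamma Gamma_real_pos)

text \<open>Since rGamma z = z rGamma (z + 1), each step of the induction divides by m + \<nu> + 1,
  which is at least m + 1. The bound lets the exponential series dominate.\<close>

lemma rGamma_le_fact:
  assumes "\<nu> \<ge> 0"
  shows "rGamma (real m + \<nu> + 1) \<le> rGamma (\<nu> + 1) / fact m"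
proof (induction m)
  case (Suc m)
  have pos: "rGamma (real m + \<nu> + 2) > 0"
    using assms by (intro rGamma_pos_real) simp
  have "(1 + real m) * rGamma (real m + \<nu> + 2) \<le> (real m + \<nu> + 1) * rGamma (real m + \<nu> + 2)"
    using pos assms by (intro mult_right_mono) auto
  also have "\<dots> = rGamma (real m + \<nu> + 1)"
    using rGamma_plus1[of "real m + \<nu> + 1"] by (simp add: add_ac)
  finally have "(1 + real m) * rGamma (real m + \<nu> + 2) \<le> rGamma (\<nu> + 1) / fact m"
    using Suc by linarith
  hence "rGamma (real m + \<nu> + 2) \<le> rGamma (\<nu> + 1) / fact m / (1 + real m)"
    by (subst pos_le_divide_eq) (auto simp: mult.commute)
  also have "\<dots> = rGamma (\<nu> + 1) / fact (Suc m)"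
    by (simp add: field_simps)
  finally show ?case by (simp add: add_ac)
qed simp

lemma summable_bessel_series:
  assumes "\<nu> \<ge> 0"
  shows "summable (\<lambda>m. rGamma (real m + \<nu> + 1) / fact m * s ^ m)"
proof (rule summable_comparison_test')
  show "summable (\<lambda>m. rGamma (\<nu> + 1) * (inverse (fact m) * \<bar>s\<bar> ^ m))"
    by (intro summable_mult summable_exp)
  fix m :: nat
  have pos: "rGamma (real m + \<nu> + 1) > 0" "rGamma (\<nu> + 1) > 0"
    using assms by (auto intro!: rGamma_pos_real)
  have "rGamma (real m + \<nu> + 1) \<le> rGamma (\<nu> + 1) / fact m"
    by (rule rGamma_le_fact[OF assms])
  also have "\<dots> \<le> rGamma (\<nu> + 1)"
    using pos fact_ge_1[of m, where 'a = real] by (simp add: field_simps del: fact_ge_1)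
  finally show "norm (rGamma (real m + \<nu> + 1) / fact m * s ^ m)
      \<le> rGamma (\<nu> + 1) * (inverse (fact m) * \<bar>s\<bar> ^ m)"
    using pos by (simp add: abs_mult power_abs divide_inverse mult.assoc mult_right_mono)
qed

text \<open>Differentiation raises the order: the factor n + 1 cancels against
  \<open>fact (Suc n)\<close>, and the index shift moves the argument of \<open>rGamma\<close> by
  one.\<close>

lemma bessel_series_deriv:
  assumes "\<nu> \<ge> 0"
  shows "(bessel_series \<nu> has_real_derivative bessel_series (\<nu> + 1) s) (at s)"
proof -
  have "((\<lambda>x. \<Sum>n. rGamma (real n + \<nu> + 1) / fact n * x ^ n) has_real_derivative
      (\<Sum>n. diffs (\<lambda>n. rGamma (real n + \<nu> + 1) / fact n) n * s ^ n)) (at s)"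
    by (rule termdiffs_strong_converges_everywhere) (rule summable_bessel_series[OF assms])
  moreover have "diffs (\<lambda>n. rGamma (real n + \<nu> + 1) / fact n) n
      = rGamma (real n + (\<nu> + 1) + 1) / fact n" for n
    by (simp add: diffs_def add_ac divide_simps)
  ultimately show ?thesis
    unfolding bessel_series_def[abs_def] by simp
qed

lemma continuous_on_bessel_series:
  assumes "\<nu> \<ge> 0" "continuous_on S g"
  shows "continuous_on S (\<lambda>x. bessel_series \<nu> (g x))"
proof -
  have "continuous_on UNIV (bessel_series \<nu>)"
    using bessel_series_deriv[OF assms(1)] DERIV_isCont
    by (blast intro: continuous_at_imp_continuous_on)
  thus ?thesis
    using continuous_on_compose2[OF _ assms(2)] by blast
qed

lemma bessel_series_nonneg:
  assumes "\<nu> \<ge> 0" "s \<ge> 0"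
  shows "bessel_series \<nu> s \<ge> 0"
  unfolding bessel_series_def
  by (intro suminf_nonneg summable_bessel_series mult_nonneg_nonneg divide_nonneg_nonneg
        less_imp_le[OF rGamma_pos_real]) (use assms in auto)

text \<open>As derivatives raise the order, this is the equation s E'' + (\<nu> + 1) E' = E without
  derivatives. Coefficientwise it is (m + \<nu> + 1) rGamma (m + \<nu> + 2) = rGamma (m + \<nu> +
  1).\<close>

lemma bessel_series_recurrence:
  assumes "\<nu> \<ge> 0"
  shows "s * bessel_series (\<nu> + 2) s + (\<nu> + 1) * bessel_series (\<nu> + 1) s = bessel_series \<nu> s"
proof -
  have 1: "(\<lambda>m. rGamma (real m + (\<nu> + 2) + 1) / fact m * s ^ m) sums bessel_series (\<nu> + 2) s"
    unfolding bessel_series_def using assms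
    by (intro summable_sums summable_bessel_series) auto
  \<comment> \<open>Multiplication by s shifts the index by one; the factor \<open>real m\<close>
    makes the term at m = 0 vanish, so the shifted series may again start at 0.\<close>
  have "(\<lambda>m. real m * rGamma (real m + \<nu> + 2) / fact m * s ^ m) sums (s * bessel_series (\<nu> + 2) s)"
  proof (rule sums_Suc_imp)
    have "real (Suc m) * rGamma (real (Suc m) + \<nu> + 2) / fact (Suc m) * s ^ Suc m
        = s * (rGamma (real m + (\<nu> + 2) + 1) / fact m * s ^ m)" for m
    proof -
      have arg: "real (Suc m) + \<nu> + 2 = real m + (\<nu> + 2) + 1" by simp
      have fact: "real (Suc m) / fact (Suc m) = (1 / fact m :: real)"
        by (simp add: divide_simps)
      have "real (Suc m) * rGamma (real (Suc m) + \<nu> + 2) / fact (Suc m) * s ^ Suc m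
          = (real (Suc m) / fact (Suc m)) * rGamma (real (Suc m) + \<nu> + 2) * (s * s ^ m)"
        by simp
      thus ?thesis unfolding fact arg by simp
    qed
    thus "(\<lambda>m. real (Suc m) * rGamma (real (Suc m) + \<nu> + 2) / fact (Suc m) * s ^ Suc m)
        sums (s * bessel_series (\<nu> + 2) s)"
      using sums_mult[OF 1, of s] by (simp only:)
  qed simp
  moreover have "(\<lambda>m. rGamma (real m + (\<nu> + 1) + 1) / fact m * s ^ m) sums bessel_series (\<nu> + 1) s"
    unfolding bessel_series_def using assms
    by (intro summable_sums summable_bessel_series) auto
  hence "(\<lambda>m. (\<nu> + 1) * (rGamma (real m + \<nu> + 2) / fact m * s ^ m)) sums ((\<nu> + 1) * bessel_series (\<nu> + 1) s)"
    by (intro sums_mult) (simp add: add_ac)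
  ultimately have "(\<lambda>m. real m * rGamma (real m + \<nu> + 2) / fact m * s ^ m +
      (\<nu> + 1) * (rGamma (real m + \<nu> + 2) / fact m * s ^ m))
      sums (s * bessel_series (\<nu> + 2) s + (\<nu> + 1) * bessel_series (\<nu> + 1) s)"
    by (rule sums_add)
  moreover have "real m * rGamma (real m + \<nu> + 2) / fact m * s ^ m +
      (\<nu> + 1) * (rGamma (real m + \<nu> + 2) / fact m * s ^ m)
      = rGamma (real m + \<nu> + 1) / fact m * s ^ m" for m
  proof -
    have "rGamma (real m + \<nu> + 1) = (real m + \<nu> + 1) * rGamma (real m + \<nu> + 2)"
      using rGamma_plus1[of "real m + \<nu> + 1"] by (simp add: add_ac)
    thus ?thesis by (simp add: field_simps)
  qed
  ultimately show ?thesis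
    unfolding bessel_series_def[of \<nu>] by (simp add: sums_unique)
qed

lemma bessel_I_eq_bessel_series:
  assumes "\<nu> \<ge> 0" "z > 0"
  shows "bessel_I \<nu> z = (z / 2) powr \<nu> * bessel_series \<nu> ((z / 2)\<^sup>2)"
proof -
  have "(z / 2) powr (2 * real m + \<nu>) * rGamma (real m + \<nu> + 1) / fact m
      = (z / 2) powr \<nu> * (rGamma (real m + \<nu> + 1) / fact m * ((z / 2)\<^sup>2) ^ m)" for m
  proof -
    have "(z / 2) powr (2 * real m) = ((z / 2)\<^sup>2) ^ m"
      using assms powr_realpow[of "z / 2" "2 * m"] by (simp add: power_mult)
    thus ?thesis by (simp add: powr_add)
  qed
  thus ?thesis
    unfolding bessel_I_def bessel_series_def
    by (simp only: suminf_mult[OF summable_bessel_series[OF assms(1)]])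
qed

section \<open>Laplace transforms of powers and of the entire series\<close>

lemma has_bochner_integral_powr_exp:
  fixes z p :: real
  assumes "z > 0" "p > 0"
  shows "has_bochner_integral lborel
    (\<lambda>y. indicator {0..} y * (y powr (z - 1) * exp (- (p * y)))) (Gamma z / p powr z)"
proof -
  \<comment> \<open>Euler's integral for Gamma is the case p = 1. The general case is the
    substitution of p y for the variable, followed by division by
    \<open>p powr (z - 1)\<close>.\<close>
  have 1: "has_bochner_integral lborel
      (\<lambda>t. indicator {0..} t * (t powr (z - 1) / exp t)) (Gamma z)"
  proof (rule has_bochner_integral_nn_integral)
    show "(\<integral>\<^sup>+ t. ennreal (indicator {0..} t * (t powr (z - 1) / exp t)) \<partial>lborel) = ennreal (Gamma z)"
      by (rule nn_integral_has_integral_lebesgue[OF _ Gamma_integral_real[OF assms(1)]]) simp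
  qed (use assms Gamma_real_pos[of z] in \<open>auto simp: less_imp_le\<close>)
  have "has_bochner_integral lborel
     (\<lambda>y. indicator {0..} (0 + p * y) * ((0 + p * y) powr (z - 1) / exp (0 + p * y)))
     (Gamma z /\<^sub>R \<bar>p\<bar>)"
    by (rule lborel_has_bochner_integral_real_affine_iff[THEN iffD1]) (use 1 assms in auto)
  from has_bochner_integral_mult_right[OF this, of "inverse (p powr (z - 1))"]
  have "has_bochner_integral lborel
     (\<lambda>y. inverse (p powr (z - 1)) * (indicator {0..} (0 + p * y) *
        ((0 + p * y) powr (z - 1) / exp (0 + p * y))))
     (inverse (p powr (z - 1)) * (Gamma z /\<^sub>R \<bar>p\<bar>))" by simp
  also have "inverse (p powr (z - 1)) * (Gamma z /\<^sub>R \<bar>p\<bar>) = Gamma z / p powr z"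
    using assms by (simp add: powr_diff field_simps)
  also have "(\<lambda>y. inverse (p powr (z - 1)) * (indicator {0..} (0 + p * y) *
        ((0 + p * y) powr (z - 1) / exp (0 + p * y))))
     = (\<lambda>y. indicator {0..} y * (y powr (z - 1) * exp (- (p * y))))"
    using assms
    by (auto simp: fun_eq_iff indicator_def powr_mult exp_minus field_simps zero_le_mult_iff)
  finally show ?thesis .
qed

text \<open>The m-th term integrates to a multiple of Gamma (m + \<nu> + 1), which cancels its
  \<open>rGamma\<close> coefficient and leaves the exponential series in q / p. All terms are
  nonnegative, so sum and integral commute, and integrability comes with the value.\<close>

lemma has_bochner_integral_bessel_series:
  assumes "\<nu> \<ge> 0" "p > 0" "q \<ge> 0"
  shows "has_bochner_integral lborel
    (\<lambda>y. indicator {0..} y * (y powr \<nu> * exp (- (p * y)) * bessel_series \<nu> (q * y)))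
    (exp (q / p) / p powr (\<nu> + 1))"
proof (rule has_bochner_integral_nn_integral)
  define g where "g m y = indicator {0..} y *
     (y powr \<nu> * exp (- (p * y)) * (rGamma (real m + \<nu> + 1) / fact m * (q * y) ^ m))" for m y
  have g_nonneg: "g m y \<ge> 0" for m y
    unfolding g_def using assms rGamma_pos_real[of "real m + \<nu> + 1"]
    by (auto simp: indicator_def)
  have [measurable]: "g m \<in> borel_measurable borel" for m
    unfolding g_def by measurable
  have g_int: "(\<integral>\<^sup>+ y. ennreal (g m y) \<partial>lborel)
      = ennreal (1 / p powr (\<nu> + 1) * ((q / p) ^ m /\<^sub>R fact m))" for m
  proof -
    have z: "real m + \<nu> + 1 > 0" using assms by simp
    from has_bochner_integral_mult_right[OF has_bochner_integral_powr_exp[OF z assms(2)],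
        of "rGamma (real m + \<nu> + 1) / fact m * q ^ m"]
    have "has_bochner_integral lborel (\<lambda>y. rGamma (real m + \<nu> + 1) / fact m * q ^ m *
        (indicator {0..} y * (y powr (real m + \<nu>) * exp (- (p * y)))))
        (rGamma (real m + \<nu> + 1) / fact m * q ^ m *
          (Gamma (real m + \<nu> + 1) / p powr (real m + \<nu> + 1)))"
      by simp
    also have "(\<lambda>y. rGamma (real m + \<nu> + 1) / fact m * q ^ m *
        (indicator {0..} y * (y powr (real m + \<nu>) * exp (- (p * y))))) = g m"
    proof
      fix y :: real
      have "y powr (real m + \<nu>) = y powr \<nu> * y ^ m" if "y > 0"
        using that by (simp add: powr_add powr_realpow)
      \<comment> \<open>\<open>0 powr e\<close> is 0 for every exponent, also for e = 0, so both
        sides vanish at the endpoint.\<close>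
      moreover have "y powr (real m + \<nu>) = y powr \<nu> * y ^ m" if "y = 0"
        using that by simp
      ultimately have "y powr (real m + \<nu>) = y powr \<nu> * y ^ m" if "y \<ge> 0"
        using that by fastforce
      thus "rGamma (real m + \<nu> + 1) / fact m * q ^ m *
        (indicator {0..} y * (y powr (real m + \<nu>) * exp (- (p * y)))) = g m y"
        by (auto simp: g_def indicator_def power_mult_distrib)
    qed
    also have "rGamma (real m + \<nu> + 1) / fact m * q ^ m *
          (Gamma (real m + \<nu> + 1) / p powr (real m + \<nu> + 1))
        = 1 / p powr (\<nu> + 1) * ((q / p) ^ m /\<^sub>R fact m)"
    proof -
      have "p powr (real m + \<nu> + 1) = p ^ m * p powr (\<nu> + 1)"
        using assms by (simp add: powr_add powr_realpow)
      moreover have "rGamma (real m + \<nu> + 1) * Gamma (real m + \<nu> + 1) = 1"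
        using Gamma_real_pos[OF z] by (simp add: rGamma_inverse_Gamma)
      ultimately show ?thesis
        using assms by (simp add: power_divide divide_simps)
    qed
    finally have *: "has_bochner_integral lborel (g m)
       (1 / p powr (\<nu> + 1) * ((q / p) ^ m /\<^sub>R fact m))" .
    show ?thesis
      using nn_integral_eq_integral[of lborel "g m"] * g_nonneg
      by (simp add: has_bochner_integral_iff)
  qed
  have g_sum: "(\<lambda>m. g m y) sums
      (indicator {0..} y * (y powr \<nu> * exp (- (p * y)) * bessel_series \<nu> (q * y)))" for y
    unfolding g_def bessel_series_def
    by (intro sums_mult summable_sums summable_bessel_series assms)
  show "(\<integral>\<^sup>+ y. ennreal (indicator {0..} y *
      (y powr \<nu> * exp (- (p * y)) * bessel_series \<nu> (q * y))) \<partial>lborel)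
      = ennreal (exp (q / p) / p powr (\<nu> + 1))"
  proof -
    have "(\<integral>\<^sup>+ y. ennreal (indicator {0..} y *
        (y powr \<nu> * exp (- (p * y)) * bessel_series \<nu> (q * y))) \<partial>lborel)
        = (\<integral>\<^sup>+ y. (\<Sum>m. ennreal (g m y)) \<partial>lborel)"
      by (intro nn_integral_cong) (metis g_sum g_nonneg suminf_ennreal_eq)
    also have "\<dots> = (\<Sum>m. \<integral>\<^sup>+ y. ennreal (g m y) \<partial>lborel)"
      by (intro nn_integral_suminf) measurable
    also have "\<dots> = (\<Sum>m. ennreal (1 / p powr (\<nu> + 1) * ((q / p) ^ m /\<^sub>R fact m)))"
      by (simp add: g_int)
    also have "\<dots> = ennreal (1 / p powr (\<nu> + 1) * exp (q / p))"
      using assms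
      by (intro suminf_ennreal_eq sums_mult exp_converges) auto
    finally show ?thesis by simp
  qed
  have [measurable]: "bessel_series \<nu> \<in> borel_measurable borel"
    by (intro borel_measurable_continuous_onI continuous_on_bessel_series assms continuous_on_id)
  show "(\<lambda>y. indicator {0..} y * (y powr \<nu> * exp (- (p * y)) * bessel_series \<nu> (q * y)))
      \<in> borel_measurable lborel"
    by measurable
  show "AE y in lborel. 0 \<le> indicator {0..} y *
      (y powr \<nu> * exp (- (p * y)) * bessel_series \<nu> (q * y))"
    using assms by (intro AE_I2) (auto simp: indicator_def bessel_series_nonneg)
qed (use assms in auto)

section \<open>Convergence to a point mass\<close>

text \<open>Near x continuity gives \<epsilon>. Away from x the left side is at most 2N, while
  strict monotonicity of exp keeps the square above a positive constant; M is the quotient of the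
  two.\<close>

lemma exp_quadratic_modulus:
  fixes \<psi> :: "real \<Rightarrow> real"
  assumes cont: "isCont \<psi> x" and bdd: "\<And>y. \<bar>\<psi> y\<bar> \<le> N" and "\<epsilon> > 0"
  obtains M where "M \<ge> 0" "\<And>y. \<bar>\<psi> y - \<psi> x\<bar> \<le> \<epsilon> + M * (exp (- y) - exp (- x))\<^sup>2"
proof -
  obtain \<delta> where \<delta>: "\<delta> > 0" "\<And>y. \<bar>y - x\<bar> < \<delta> \<Longrightarrow> \<bar>\<psi> y - \<psi> x\<bar> < \<epsilon>"
    using cont \<open>\<epsilon> > 0\<close> unfolding continuous_at_eps_delta dist_real_def by metis
  \<comment> \<open>The smaller of the distances from exp (-x) to the values of exp (-y) at y = x +
    \<delta> and y = x - \<delta>.\<close>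
  define \<eta> where "\<eta> = min (exp (- x) - exp (- (x + \<delta>))) (exp (- (x - \<delta>)) - exp (- x))"
  have \<eta>: "\<eta> > 0" unfolding \<eta>_def using \<delta>(1) by simp
  have N: "N \<ge> 0" using bdd[of 0] by linarith
  have "\<bar>\<psi> y - \<psi> x\<bar> \<le> \<epsilon> + 2 * N / \<eta>\<^sup>2 * (exp (- y) - exp (- x))\<^sup>2" for y
  proof (cases "\<bar>y - x\<bar> < \<delta>")
    case True
    have "0 \<le> 2 * N / \<eta>\<^sup>2 * (exp (- y) - exp (- x))\<^sup>2" using N by simp
    thus ?thesis using \<delta>(2)[OF True] by linarith
  next
    case False
    hence "y \<ge> x + \<delta> \<or> y \<le> x - \<delta>" by linarith
    hence "\<eta> \<le> \<bar>exp (- y) - exp (- x)\<bar>"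
    proof
      assume "y \<ge> x + \<delta>"
      hence "exp (- y) \<le> exp (- (x + \<delta>))" by simp
      thus ?thesis unfolding \<eta>_def by linarith
    next
      assume "y \<le> x - \<delta>"
      hence "exp (- y) \<ge> exp (- (x - \<delta>))" by simp
      thus ?thesis unfolding \<eta>_def by linarith
    qed
    hence "\<eta>\<^sup>2 \<le> (exp (- y) - exp (- x))\<^sup>2"
      using \<eta> by (metis abs_le_square_iff abs_of_pos)
    hence "2 * N * 1 \<le> 2 * N * ((exp (- y) - exp (- x))\<^sup>2 / \<eta>\<^sup>2)"
      using N \<eta> by (intro mult_left_mono) auto
    moreover have "\<bar>\<psi> y - \<psi> x\<bar> \<le> 2 * N"
      using bdd[of y] bdd[of x] by linarith
    ultimately show ?thesis using \<open>\<epsilon> > 0\<close> by simp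
  qed
  moreover have "2 * N / \<eta>\<^sup>2 \<ge> 0" using N by simp
  ultimately show ?thesis using that by blast
qed

text \<open>A Korovkin argument: the functions \<open>1, exp (-y), exp (-2y)\<close> suffice as test functions because
  \<open>(exp (-y) - exp (-x))\<^sup>2\<close> vanishes only at \<open>y = x\<close>.\<close>

lemma korovkin_exp:
  fixes \<psi> :: "real \<Rightarrow> real" and k :: "'i \<Rightarrow> real \<Rightarrow> real" and L :: "real \<Rightarrow> 'i \<Rightarrow> real"
  assumes cont: "isCont \<psi> x" and bdd: "\<And>y. \<bar>\<psi> y\<bar> \<le> N"
    and meas: "\<psi> \<in> borel_measurable borel"
    and nonneg: "\<forall>\<^sub>F i in \<F>. \<forall>y. k i y \<ge> 0"
    and lap: "\<And>j. j \<ge> 0 \<Longrightarrow> \<forall>\<^sub>F i in \<F>. has_bochner_integral lborel (\<lambda>y. k i y * exp (- (j * y))) (L j i)"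
    and lim: "\<And>j. j \<ge> 0 \<Longrightarrow> (L j \<longlongrightarrow> H * exp (- (j * x))) \<F>"
  shows "((\<lambda>i. \<integral>y. \<psi> y * k i y \<partial>lborel) \<longlongrightarrow> \<psi> x * H) \<F>"
proof -
  have L0: "((\<lambda>i. \<psi> x * L 0 i) \<longlongrightarrow> \<psi> x * H) \<F>"
    using tendsto_mult_left[OF lim[of 0], of "\<psi> x"] by simp
  \<comment> \<open>\<open>L 0 i\<close> is the total mass of \<open>k i\<close>. Comparing with
    \<psi> x times this mass, and not yet with its limit, makes the difference a single integral of
    (\<psi> y - \<psi> x) \<open>k i y\<close>.\<close>
  have "((\<lambda>i. (\<integral>y. \<psi> y * k i y \<partial>lborel) - \<psi> x * L 0 i) \<longlongrightarrow> 0) \<F>"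
  proof (rule tendstoI)
    fix e :: real assume "e > 0"
    \<comment> \<open>Chosen such that \<epsilon> H < e; the summand 1 covers H = 0.\<close>
    define \<epsilon> where "\<epsilon> = e / (\<bar>H\<bar> + 1)"
    have \<epsilon>: "\<epsilon> > 0" unfolding \<epsilon>_def using \<open>e > 0\<close> by (intro divide_pos_pos) auto
    obtain M where M: "M \<ge> 0" "\<And>y. \<bar>\<psi> y - \<psi> x\<bar> \<le> \<epsilon> + M * (exp (- y) - exp (- x))\<^sup>2"
      using exp_quadratic_modulus[OF cont bdd \<epsilon>] by blast
    \<comment> \<open>The integral of the quadratic bound against \<open>k i\<close>, with the
      square expanded into transforms at 0, 1 and 2. In the limit these are the transforms of a
      point mass at x, so the contribution of the square vanishes.\<close>
    define R where "R i = \<epsilon> * L 0 i + M * (L 2 i - 2 * exp (- x) * L 1 i + (exp (- x))\<^sup>2 * L 0 i)" for i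
    have "(R \<longlongrightarrow> \<epsilon> * (H * exp (- (0 * x))) + M * (H * exp (- (2 * x))
        - 2 * exp (- x) * (H * exp (- (1 * x))) + (exp (- x))\<^sup>2 * (H * exp (- (0 * x))))) \<F>"
      unfolding R_def by (intro tendsto_intros lim) auto
    also have "\<epsilon> * (H * exp (- (0 * x))) + M * (H * exp (- (2 * x))
        - 2 * exp (- x) * (H * exp (- (1 * x))) + (exp (- x))\<^sup>2 * (H * exp (- (0 * x)))) = \<epsilon> * H"
      by (simp add: power2_eq_square flip: exp_add)
    finally have R: "(R \<longlongrightarrow> \<epsilon> * H) \<F>" .
    have "\<epsilon> * H \<le> \<epsilon> * \<bar>H\<bar>" using \<epsilon> by (intro mult_left_mono) auto
    also have "\<dots> < e" unfolding \<epsilon>_def using \<open>e > 0\<close> by (simp add: field_simps)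
    finally have "\<forall>\<^sub>F i in \<F>. R i < e"
      using order_tendstoD(2)[OF R] by blast
    moreover have "\<forall>\<^sub>F i in \<F>. has_bochner_integral lborel (k i) (L 0 i)"
      using lap[of 0] by simp
    ultimately show "\<forall>\<^sub>F i in \<F>. dist ((\<integral>y. \<psi> y * k i y \<partial>lborel) - \<psi> x * L 0 i) 0 < e"
      using nonneg lap[of 1, simplified] lap[of 2, simplified]
    proof eventually_elim
      case (elim i)
      have [measurable]: "\<psi> \<in> borel_measurable borel" by (rule meas)
      have ki: "integrable lborel (k i)" "integral\<^sup>L lborel (k i) = L 0 i"
        using elim(2) by (auto simp: has_bochner_integral_iff)
      have k_nonneg: "k i y \<ge> 0" for y using elim(3) by blast
      have int: "integrable lborel (\<lambda>y. \<psi> y * k i y)"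
      proof (rule Bochner_Integration.integrable_bound)
        show "integrable lborel (\<lambda>y. N * k i y)" using ki by simp
        show "(\<lambda>y. \<psi> y * k i y) \<in> borel_measurable lborel"
          using ki by measurable
        have "N \<ge> 0" using bdd[of 0] by linarith
        thus "AE y in lborel. norm (\<psi> y * k i y) \<le> norm (N * k i y)"
          using bdd k_nonneg by (intro AE_I2) (simp add: abs_mult mult_right_mono)
      qed
      have bnd: "has_bochner_integral lborel
          (\<lambda>y. \<epsilon> * k i y + M * (k i y * exp (- (2 * y)) - 2 * exp (- x) * (k i y * exp (- y))
              + (exp (- x))\<^sup>2 * k i y)) (R i)"
        unfolding R_def using elim
        by (intro has_bochner_integral_add has_bochner_integral_diff has_bochner_integral_mult_right) auto
      have "\<bar>(\<integral>y. \<psi> y * k i y \<partial>lborel) - \<psi> x * L 0 i\<bar>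
          = \<bar>\<integral>y. \<psi> y * k i y - \<psi> x * k i y \<partial>lborel\<bar>"
        using int ki by simp
      also have "\<dots> \<le> (\<integral>y. \<bar>\<psi> y * k i y - \<psi> x * k i y\<bar> \<partial>lborel)"
        by (rule integral_abs_bound)
      also have "\<dots> \<le> R i"
        unfolding has_bochner_integral_integral_eq[OF bnd, symmetric]
      proof (rule integral_mono)
        show "integrable lborel (\<lambda>y. \<bar>\<psi> y * k i y - \<psi> x * k i y\<bar>)"
          using int ki by simp
        show "integrable lborel (\<lambda>y. \<epsilon> * k i y + M * (k i y * exp (- (2 * y))
            - 2 * exp (- x) * (k i y * exp (- y)) + (exp (- x))\<^sup>2 * k i y))"
          using bnd by (simp add: has_bochner_integral_iff)
        fix y
        have "\<bar>\<psi> y * k i y - \<psi> x * k i y\<bar> = \<bar>\<psi> y - \<psi> x\<bar> * k i y"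
          using k_nonneg by (simp add: abs_mult flip: left_diff_distrib)
        also have "\<dots> \<le> (\<epsilon> + M * (exp (- y) - exp (- x))\<^sup>2) * k i y"
          by (intro mult_right_mono M k_nonneg)
        also have "(exp (- y) - exp (- x))\<^sup>2
            = exp (- (2 * y)) - 2 * exp (- x) * exp (- y) + (exp (- x))\<^sup>2"
          by (simp add: power2_eq_square algebra_simps flip: exp_add)
        finally show "\<bar>\<psi> y * k i y - \<psi> x * k i y\<bar> \<le> \<epsilon> * k i y + M * (k i y * exp (- (2 * y))
            - 2 * exp (- x) * (k i y * exp (- y)) + (exp (- x))\<^sup>2 * k i y)"
          by (simp add: algebra_simps)
      qed
      finally show ?case using elim(1) by simp
    qed
  qed
  from tendsto_add[OF this L0] show ?thesis by simp
qed

section \<open>The Riccati equation\<close>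

text \<open>The Riccati equation forces non-oscillation at the origin: for a radicand \<open>2C + \<sigma>\<^sup>2 < 0\<close> the angle
  \<open>arctan ((f - \<sigma>) / k)\<close> would grow at least like \<open>- ln x\<close> as \<open>x\<close> tends to 0.\<close>

lemma riccati_radicand_nonneg:
  fixes \<sigma> A B C :: real
  assumes \<sigma>: "\<sigma> > 0"
    and diff: "\<And>x. x > 0 \<Longrightarrow> f differentiable at x"
    and ric: "\<And>x. x > 0 \<Longrightarrow>
           \<sigma> * x * deriv f x - \<sigma> * f x + 1/2 * (f x)\<^sup>2 = 1/2 * A * x\<^sup>2 + B * x + C"
  shows "2 * C + \<sigma>\<^sup>2 \<ge> 0"
proof (rule ccontr)
  assume neg: "\<not> 2 * C + \<sigma>\<^sup>2 \<ge> 0"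
  \<comment> \<open>Completing the square turns the Riccati equation into \<sigma> x f' = Q x - (f -
    \<sigma>)^2 / 2 with the \<open>Q\<close> below, and Q 0 = -k^2. Near 0 half of this margin
    remains.\<close>
  define k where "k = sqrt (- (2 * C + \<sigma>\<^sup>2) / 2)"
  have k: "k > 0" "k\<^sup>2 = - (2 * C + \<sigma>\<^sup>2) / 2"
    unfolding k_def using neg by auto
  define Q where "Q x = 1/2 * A * x\<^sup>2 + B * x + C + \<sigma>\<^sup>2 / 2" for x
  have "isCont Q 0" unfolding Q_def by (intro continuous_intros)
  moreover have "Q 0 < - k\<^sup>2 / 2" using k neg by (simp add: Q_def)
  ultimately have "\<forall>\<^sub>F x in at 0. Q x < - k\<^sup>2 / 2"
    unfolding isCont_def by (rule order_tendstoD(2))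
  then obtain d where d: "d > 0" "\<And>x. x \<noteq> 0 \<Longrightarrow> \<bar>x\<bar> < d \<Longrightarrow> Q x < - k\<^sup>2 / 2"
    unfolding eventually_at dist_real_def by auto
  \<comment> \<open>The angle has derivative k f' / (k^2 + (f - \<sigma>)^2), which is at most -k /
    (2 \<sigma> x) near 0. The logarithm compensates exactly this rate, so \<open>G\<close> is
    nonincreasing there.\<close>
  define G where "G x = arctan ((f x - \<sigma>) / k) + k / (2 * \<sigma>) * ln x" for x
  have deriv: "\<exists>D. (G has_real_derivative D) (at x) \<and> D \<le> 0" if x: "0 < x" "x < d" for x
  proof -
    have f': "(f has_real_derivative deriv f x) (at x)"
      using diff[OF x(1)] by (simp add: DERIV_deriv_iff_real_differentiable)
    define D where "D = inverse (1 + ((f x - \<sigma>) / k)\<^sup>2) * (deriv f x / k) + k / (2 * \<sigma>) * (1 / x)"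
    have "(G has_real_derivative D) (at x)"
      unfolding G_def D_def using x k(1) \<sigma> by (auto intro!: derivative_eq_intros f')
    moreover have "D \<le> 0"
    proof -
      have "\<sigma> * x * deriv f x = Q x - (f x - \<sigma>)\<^sup>2 / 2"
        using ric[OF x(1)] by (simp add: Q_def power2_eq_square field_simps)
      hence *: "\<sigma> * x * deriv f x \<le> - (k\<^sup>2 + (f x - \<sigma>)\<^sup>2) / 2"
        using d(2)[of x] x by simp
      have pos: "k\<^sup>2 + (f x - \<sigma>)\<^sup>2 > 0" using k(1) by (simp add: add_pos_nonneg)
      have "D = k / (\<sigma> * x * (k\<^sup>2 + (f x - \<sigma>)\<^sup>2)) *
          (\<sigma> * x * deriv f x + (k\<^sup>2 + (f x - \<sigma>)\<^sup>2) / 2)"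
      proof -
        have "1 + ((f x - \<sigma>) / k)\<^sup>2 = (k\<^sup>2 + (f x - \<sigma>)\<^sup>2) / k\<^sup>2"
          using k(1) by (simp add: power_divide field_simps)
        thus ?thesis
          unfolding D_def using k(1) \<sigma> x(1) pos
          by (simp add: divide_simps) (simp add: power2_eq_square algebra_simps)
      qed
      also have "\<dots> \<le> 0"
      proof (rule mult_nonneg_nonpos)
        show "0 \<le> k / (\<sigma> * x * (k\<^sup>2 + (f x - \<sigma>)\<^sup>2))"
          by (intro divide_nonneg_nonneg mult_nonneg_nonneg less_imp_le[OF k(1)] less_imp_le[OF \<sigma>]
                less_imp_le[OF x(1)] less_imp_le[OF pos])
        show "\<sigma> * x * deriv f x + (k\<^sup>2 + (f x - \<sigma>)\<^sup>2) / 2 \<le> 0"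
          using * by linarith
      qed
      finally show ?thesis .
    qed
    ultimately show ?thesis by blast
  qed
  have mono: "G (d / 2) \<le> G x" if x: "0 < x" "x \<le> d / 2" for x
  proof (rule DERIV_nonpos_imp_nonincreasing[OF x(2)])
    fix y assume "x \<le> y" "y \<le> d / 2"
    thus "\<exists>D. (G has_real_derivative D) (at y) \<and> D \<le> 0"
      using x d(1) by (intro deriv) linarith+
  qed
  \<comment> \<open>The contradiction: \<open>G x\<close> stays above \<open>G (d / 2)\<close> as x
    decreases to 0, although its arctan part is below pi / 2 and its logarithmic part tends to minus
    infinity.\<close>
  have "filterlim (\<lambda>x. k / (2 * \<sigma>) * ln x) at_bot (at_right 0)"
    using k \<sigma> by (intro filterlim_tendsto_pos_mult_at_bot[OF tendsto_const _ ln_at_0]) auto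
  hence "\<forall>\<^sub>F x in at_right 0. k / (2 * \<sigma>) * ln x < G (d / 2) - pi / 2"
    by (simp add: filterlim_at_bot_dense)
  moreover have "\<forall>\<^sub>F x in at_right 0. x \<in> {0<..<d/2}"
    using d(1) by (intro eventually_at_right_real) auto
  ultimately have "\<forall>\<^sub>F x in at_right (0::real). False"
  proof eventually_elim
    case (elim x)
    have "arctan ((f x - \<sigma>) / k) < pi / 2" by (rule arctan_ubound)
    thus ?case using elim mono[of x] by (auto simp: G_def)
  qed
  thus False by simp
qed

section \<open>The differential equation\<close>

text \<open>The integral has a convenient formula only in the open quadrant. Openness suffices to
  transfer derivatives; for the second one the first derivative is identified on a whole
  neighbourhood of x, not only at x.\<close>

lemma solves_pdeI:
  assumes eq: "\<And>t x. t > 0 \<Longrightarrow> x > 0 \<Longrightarrow> u t x = v t x"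
    and dt: "\<And>t x. t > 0 \<Longrightarrow> x > 0 \<Longrightarrow> ((\<lambda>s. v s x) has_real_derivative vt t x) (at t)"
    and dx: "\<And>t x. t > 0 \<Longrightarrow> x > 0 \<Longrightarrow> (v t has_real_derivative vx t x) (at x)"
    and dxx: "\<And>t x. t > 0 \<Longrightarrow> x > 0 \<Longrightarrow> (vx t has_real_derivative vxx t x) (at x)"
    and pde: "\<And>t x. t > 0 \<Longrightarrow> x > 0 \<Longrightarrow>
      vt t x = \<sigma> * x * vxx t x + f x * vx t x - \<mu> / x * v t x"
  shows "solves_pde \<sigma> f \<mu> u"
  unfolding solves_pde_def
proof (intro allI impI)
  fix t x :: real assume tx: "t > 0" "x > 0"
  have ut: "((\<lambda>s. u s x) has_real_derivative vt t x) (at t)"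
    by (rule has_field_derivative_transform_within_open[OF dt[OF tx], of "{0<..}"])
       (use tx eq in auto)
  have ux: "(u t has_real_derivative vx t y) (at y)" if "y > 0" for y
    by (rule has_field_derivative_transform_within_open[OF dx[OF tx(1) that], of "{0<..}"])
       (use tx that eq in auto)
  have uxx: "(deriv (u t) has_real_derivative vxx t x) (at x)"
    by (rule has_field_derivative_transform_within_open[OF dxx[OF tx], of "{0<..}"])
       (use tx DERIV_imp_deriv[OF ux] in auto)
  show "(\<lambda>s. u s x) differentiable at t \<and> u t differentiable at x \<and>
        deriv (u t) differentiable at x \<and>
        deriv (\<lambda>s. u s x) t
          = \<sigma> * x * deriv (deriv (u t)) x + f x * deriv (u t) x - \<mu> / x * u t x"
    using ut ux[OF tx(2)] uxx pde[OF tx] eq[OF tx]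
    by (auto simp: DERIV_imp_deriv real_differentiable_def)
qed

section \<open>Moments of the datum and differentiation under the integral sign\<close>

definition bessel_moment ::
    "real \<Rightarrow> real \<Rightarrow> (real \<Rightarrow> real) \<Rightarrow> real \<Rightarrow> real \<Rightarrow> real \<Rightarrow> real" where
  "bessel_moment \<alpha> \<beta> g \<nu> c q =
     integral {\<alpha>..\<beta>} (\<lambda>y. g y * exp (- (c * y)) * bessel_series \<nu> (q * y))"

lemma bessel_moment_integrable:
  assumes "continuous_on {\<alpha>..\<beta>} g" "\<nu> \<ge> 0"
  shows "(\<lambda>y. g y * exp (- (c * y)) * bessel_series \<nu> (q * y)) integrable_on {\<alpha>..\<beta>}"
  by (intro integrable_continuous_real continuous_on_mult continuous_on_bessel_series
        continuous_on_exp continuous_on_minus continuous_on_const continuous_on_id assms)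

text \<open>By the Leibniz rule, the exponential contributes -c' y, and the series contributes q' y
  together with a raised order. With c and q arbitrary functions of a positive parameter, the rule
  serves for both the time and the space derivative.\<close>

lemma bessel_moment_deriv:
  assumes g: "continuous_on {\<alpha>..\<beta>} g" and \<nu>: "\<nu> \<ge> 0" and s: "s > 0"
    and c: "\<And>s. s > 0 \<Longrightarrow> (c has_real_derivative c' s) (at s)" "continuous_on {0<..} c'"
    and q: "\<And>s. s > 0 \<Longrightarrow> (q has_real_derivative q' s) (at s)" "continuous_on {0<..} q'"
  shows "((\<lambda>s. bessel_moment \<alpha> \<beta> g \<nu> (c s) (q s)) has_real_derivative
     q' s * bessel_moment \<alpha> \<beta> (\<lambda>y. y * g y) (\<nu> + 1) (c s) (q s)
     - c' s * bessel_moment \<alpha> \<beta> (\<lambda>y. y * g y) \<nu> (c s) (q s)) (at s)"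
proof -
  have cc: "continuous_on {0<..} c" "continuous_on {0<..} q"
    by (auto intro!: continuous_at_imp_continuous_on DERIV_isCont c(1) q(1))
  define h where "h s y = g y * exp (- (c s * y)) * bessel_series \<nu> (q s * y)" for s y
  define h1 where "h1 s y = y * g y * exp (- (c s * y)) * bessel_series (\<nu> + 1) (q s * y)" for s y
  define h2 where "h2 s y = y * g y * exp (- (c s * y)) * bessel_series \<nu> (q s * y)" for s y
  have int: "h s integrable_on {\<alpha>..\<beta>}" "h1 s integrable_on {\<alpha>..\<beta>}" "h2 s integrable_on {\<alpha>..\<beta>}"
    for s
    unfolding h_def h1_def h2_def using \<nu>
    by (auto intro!: bessel_moment_integrable continuous_on_mult g)
  have "((\<lambda>s. integral (cbox \<alpha> \<beta>) (h s)) has_real_derivative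
      integral (cbox \<alpha> \<beta>) (\<lambda>y. q' s * h1 s y - c' s * h2 s y)) (at s within {0<..})"
  proof (rule leibniz_rule_field_derivative)
    fix s y :: real assume "s \<in> {0<..}" "y \<in> cbox \<alpha> \<beta>"
    hence c': "(c has_real_derivative c' s) (at s within {0<..})"
      and q': "(q has_real_derivative q' s) (at s within {0<..})"
      by (auto intro: has_field_derivative_at_within c(1) q(1))
    have "((\<lambda>s. h s y) has_real_derivative
        g y * (exp (- (c s * y)) * (- (c' s * y))) * bessel_series \<nu> (q s * y)
        + (bessel_series (\<nu> + 1) (q s * y) * (q' s * y)) * (g y * exp (- (c s * y))))
        (at s within {0<..})"
      unfolding h_def
      by (intro DERIV_mult DERIV_cmult DERIV_chain2[OF DERIV_exp] DERIV_minus DERIV_cmult_right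
            DERIV_chain2[OF bessel_series_deriv[OF \<nu>]] c' q')
    thus "((\<lambda>s. h s y) has_real_derivative q' s * h1 s y - c' s * h2 s y) (at s within {0<..})"
      by (rule DERIV_cong) (simp add: h1_def h2_def algebra_simps)
  next
    have fst: "continuous_on ({0<..} \<times> {\<alpha>..\<beta>}) (\<lambda>z. k (fst z))"
      if "continuous_on {0<..} k" for k :: "real \<Rightarrow> real"
      by (rule continuous_on_compose2[OF that continuous_on_fst[OF continuous_on_id]]) auto
    have snd: "continuous_on ({0<..} \<times> {\<alpha>..\<beta>}) (\<lambda>z. g (snd z))"
      by (rule continuous_on_compose2[OF g continuous_on_snd[OF continuous_on_id]]) auto
    have \<nu>': "\<nu> + 1 \<ge> 0" using \<nu> by simp
    show "continuous_on ({0<..} \<times> cbox \<alpha> \<beta>) (\<lambda>(s, y). q' s * h1 s y - c' s * h2 s y)"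
      unfolding h1_def h2_def case_prod_unfold cbox_interval
      by (intro continuous_on_diff continuous_on_mult continuous_on_bessel_series[OF \<nu>]
            continuous_on_bessel_series[OF \<nu>'] continuous_on_exp continuous_on_minus snd
            fst[OF c(2)] fst[OF q(2)] fst[OF cc(1)] fst[OF cc(2)]
            continuous_on_snd[OF continuous_on_id])
  qed (use s int in auto)
  moreover have "integral (cbox \<alpha> \<beta>) (\<lambda>y. q' s * h1 s y - c' s * h2 s y)
      = q' s * integral {\<alpha>..\<beta>} (h1 s) - c' s * integral {\<alpha>..\<beta>} (h2 s)"
    using int[of s]
    by (simp add: Henstock_Kurzweil_Integration.integral_diff integrable_on_mult_right)
  moreover have "at s within {0<..} = at s"
    using s by (intro at_within_open) auto
  ultimately show ?thesis
    unfolding bessel_moment_def h_def h1_def h2_def by simp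
qed

text \<open>The recurrence for the series at q y, integrated. It expresses the moment that arises
  from the time derivative through those that arise from the space derivatives.\<close>

lemma bessel_moment_recurrence:
  assumes g: "continuous_on {\<alpha>..\<beta>} g" and \<nu>: "\<nu> \<ge> 0"
  shows "bessel_moment \<alpha> \<beta> (\<lambda>y. y * g y) \<nu> c q
    = q * bessel_moment \<alpha> \<beta> (\<lambda>y. y * (y * g y)) (\<nu> + 2) c q
      + (\<nu> + 1) * bessel_moment \<alpha> \<beta> (\<lambda>y. y * g y) (\<nu> + 1) c q"
proof -
  have "bessel_moment \<alpha> \<beta> (\<lambda>y. y * g y) \<nu> c q = integral {\<alpha>..\<beta>} (\<lambda>y.
      q * (y * (y * g y) * exp (- (c * y)) * bessel_series (\<nu> + 2) (q * y))
      + (\<nu> + 1) * (y * g y * exp (- (c * y)) * bessel_series (\<nu> + 1) (q * y)))"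
    unfolding bessel_moment_def
    by (rule arg_cong[of _ _ "integral {\<alpha>..\<beta>}"], rule ext,
        subst bessel_series_recurrence[OF \<nu>, symmetric]) (simp add: algebra_simps)
  also have "\<dots> = q * integral {\<alpha>..\<beta>} (\<lambda>y. y * (y * g y) * exp (- (c * y)) * bessel_series (\<nu> + 2) (q * y))
      + (\<nu> + 1) * integral {\<alpha>..\<beta>} (\<lambda>y. y * g y * exp (- (c * y)) * bessel_series (\<nu> + 1) (q * y))"
    by (subst Henstock_Kurzweil_Integration.integral_add)
       (use \<nu> in \<open>auto intro!: integrable_on_mult_right bessel_moment_integrable
          continuous_on_mult g\<close>)
  finally show ?thesis unfolding bessel_moment_def .
qed

section \<open>Hyperbolic coefficients and verification of the equation\<close>

definition kcoth :: "real \<Rightarrow> real \<Rightarrow> real \<Rightarrow> real" where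
  "kcoth \<sigma> a t = a * cosh (\<sigma> * a * t) / sinh (\<sigma> * a * t)"

definition kcsch :: "real \<Rightarrow> real \<Rightarrow> real \<Rightarrow> real" where
  "kcsch \<sigma> a t = a / sinh (\<sigma> * a * t)"

context
  fixes \<sigma> a :: real
  assumes \<sigma>: "\<sigma> > 0" and a: "a > 0"
begin

lemma sinh_scaled_pos: "t > 0 \<Longrightarrow> sinh (\<sigma> * a * t) > 0"
  using \<sigma> a by simp

lemma kcsch_pos: "t > 0 \<Longrightarrow> kcsch \<sigma> a t > 0"
  unfolding kcsch_def using sinh_scaled_pos a by simp

lemma kcoth_pos: "t > 0 \<Longrightarrow> kcoth \<sigma> a t > 0"
  unfolding kcoth_def using sinh_scaled_pos a by simp

lemma kcoth_squared:
  assumes "t > 0"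
  shows "(kcoth \<sigma> a t)\<^sup>2 = a\<^sup>2 + (kcsch \<sigma> a t)\<^sup>2"
proof -
  have "(kcoth \<sigma> a t)\<^sup>2 = a\<^sup>2 * ((sinh (\<sigma> * a * t))\<^sup>2 + 1) / (sinh (\<sigma> * a * t))\<^sup>2"
    by (simp only: kcoth_def power_divide power_mult_distrib cosh_square_eq)
  also have "\<dots> = a\<^sup>2 + (kcsch \<sigma> a t)\<^sup>2"
    unfolding kcsch_def power_divide using less_imp_neq[OF sinh_scaled_pos[OF assms]]
    by (simp add: add_divide_distrib distrib_left del: sinh_real_zero_iff)
  finally show ?thesis .
qed

lemma kcoth_deriv:
  assumes "t > 0"
  shows "(kcoth \<sigma> a has_real_derivative - (\<sigma> * (kcsch \<sigma> a t)\<^sup>2)) (at t)"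
proof -
  define S K where "S = sinh (\<sigma> * a * t)" and "K = cosh (\<sigma> * a * t)"
  have S: "S > 0" unfolding S_def by (rule sinh_scaled_pos[OF assms])
  have "(kcoth \<sigma> a has_real_derivative
      (a * (S * (\<sigma> * a)) * S - a * K * (K * (\<sigma> * a))) / (S * S)) (at t)"
    unfolding kcoth_def S_def K_def using sinh_scaled_pos[OF assms]
    by (auto intro!: derivative_eq_intros)
  also have "a * (S * (\<sigma> * a)) * S - a * K * (K * (\<sigma> * a)) = \<sigma> * a\<^sup>2 * (S\<^sup>2 - K\<^sup>2)"
    by (simp add: power2_eq_square algebra_simps)
  also have "S\<^sup>2 - K\<^sup>2 = -1"
    unfolding S_def K_def by (simp add: cosh_square_eq)
  also have "\<sigma> * a\<^sup>2 * - 1 / (S * S) = - (\<sigma> * (kcsch \<sigma> a t)\<^sup>2)"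
    by (simp add: kcsch_def S_def[symmetric] power_divide power2_eq_square)
  finally show ?thesis .
qed

lemma kcsch_deriv:
  assumes "t > 0"
  shows "(kcsch \<sigma> a has_real_derivative - (\<sigma> * kcsch \<sigma> a t * kcoth \<sigma> a t)) (at t)"
proof -
  define S K where "S = sinh (\<sigma> * a * t)" and "K = cosh (\<sigma> * a * t)"
  have "(kcsch \<sigma> a has_real_derivative (0 * S - a * (K * (\<sigma> * a))) / (S * S)) (at t)"
    unfolding kcsch_def S_def K_def using sinh_scaled_pos[OF assms]
    by (auto intro!: derivative_eq_intros)
  also have "(0 * S - a * (K * (\<sigma> * a))) / (S * S) = - (\<sigma> * kcsch \<sigma> a t * kcoth \<sigma> a t)"
    by (simp add: kcsch_def kcoth_def S_def[symmetric] K_def[symmetric])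
  finally show ?thesis .
qed

lemma continuous_on_kcsch: "continuous_on {0<..} (kcsch \<sigma> a)"
  by (intro continuous_at_imp_continuous_on ballI DERIV_isCont[OF kcsch_deriv]) simp

lemma continuous_on_kcoth: "continuous_on {0<..} (kcoth \<sigma> a)"
  by (intro continuous_at_imp_continuous_on ballI DERIV_isCont[OF kcoth_deriv]) simp

end

text \<open>The equation with the common exponential cancelled: l is the x-derivative of its
  exponent, l' the derivative of l, and \<open>4 * \<sigma>\<^sup>2 * a\<^sup>2\<close> stands for
  A. After \<open>Jy\<close> is eliminated, the coefficients of \<open>J0\<close>, \<open>J1\<close>
  and \<open>J2\<close> agree separately.\<close>

lemma pde_identity:
  fixes \<sigma> x :: real
  assumes pos: "\<sigma> > 0" "x > 0"
    and l: "l = - fx / (2 * \<sigma> * x) + (\<nu> + 1) / (2 * x) - c"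
    and l': "l' = - f' / (2 * \<sigma> * x) + fx / (2 * \<sigma> * x\<^sup>2) - (\<nu> + 1) / (2 * x\<^sup>2)"
    and ric: "\<sigma> * x * f' - \<sigma> * fx + 1/2 * fx\<^sup>2 = 1/2 * (4 * \<sigma>\<^sup>2 * a\<^sup>2) * x\<^sup>2 + B * x + C"
    and c: "c\<^sup>2 = a\<^sup>2 + r\<^sup>2"
    and \<nu>: "\<sigma>\<^sup>2 * \<nu>\<^sup>2 = 2 * C + 4 * \<mu> * \<sigma> + \<sigma>\<^sup>2"
    and Jy: "Jy = r\<^sup>2 * x * J2 + (\<nu> + 1) * J1"
  shows "(- B / (2 * \<sigma>) - (\<nu> + 1) * \<sigma> * c + \<sigma> * r\<^sup>2 * x) * J0
      + (\<sigma> * r\<^sup>2 * Jy - 2 * \<sigma> * r\<^sup>2 * c * x * J1)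
    = \<sigma> * x * (l\<^sup>2 * J0 + 2 * l * r\<^sup>2 * J1 + l' * J0 + r\<^sup>2 * r\<^sup>2 * J2)
      + fx * (l * J0 + r\<^sup>2 * J1) - \<mu> / x * J0"
proof -
  \<comment> \<open>Clearing denominators makes the comparison of the \<open>J0\<close> coefficients
    polynomial. In \<open>key\<close> the Riccati equation, c^2 = a^2 + r^2 and the value of \<nu>^2
    enter together.\<close>
  define L where "L = - fx + \<sigma> * (\<nu> + 1) - 2 * \<sigma> * x * c"
  have lL: "2 * \<sigma> * x * l = L"
    unfolding l L_def using pos by (simp add: field_simps)
  have l'L: "4 * \<sigma>\<^sup>2 * x\<^sup>2 * l' = - 2 * \<sigma> * x * f' + 2 * \<sigma> * fx - 2 * \<sigma>\<^sup>2 * (\<nu> + 1)"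
    unfolding l' using pos by (simp add: field_simps power2_eq_square)
  have key: "L\<^sup>2 + (- 2 * \<sigma> * x * f' + 2 * \<sigma> * fx - 2 * \<sigma>\<^sup>2 * (\<nu> + 1)) + 2 * fx * L - 4 * \<sigma> * \<mu>
      = - 2 * B * x - 4 * \<sigma>\<^sup>2 * x * (\<nu> + 1) * c + 4 * \<sigma>\<^sup>2 * r\<^sup>2 * x\<^sup>2"
    using ric c \<nu> unfolding L_def by algebra
  have "4 * \<sigma> * x * (\<sigma> * x * (l\<^sup>2 + l') + fx * l - \<mu> / x)
      = (2 * \<sigma> * x * l)\<^sup>2 + 4 * \<sigma>\<^sup>2 * x\<^sup>2 * l' + 2 * fx * (2 * \<sigma> * x * l) - 4 * \<sigma> * \<mu>"
    using pos by (simp add: power2_eq_square algebra_simps)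
  also have "\<dots> = - 2 * B * x - 4 * \<sigma>\<^sup>2 * x * (\<nu> + 1) * c + 4 * \<sigma>\<^sup>2 * r\<^sup>2 * x\<^sup>2"
    unfolding lL l'L using key by simp
  also have "\<dots> = 4 * \<sigma> * x * (- B / (2 * \<sigma>) - (\<nu> + 1) * \<sigma> * c + \<sigma> * r\<^sup>2 * x)"
    using pos by (simp add: power2_eq_square algebra_simps)
  finally have J0: "\<sigma> * x * (l\<^sup>2 + l') + fx * l - \<mu> / x
      = - B / (2 * \<sigma>) - (\<nu> + 1) * \<sigma> * c + \<sigma> * r\<^sup>2 * x"
    using pos by simp
  have J1: "\<sigma> * r\<^sup>2 * (\<nu> + 1) - 2 * \<sigma> * r\<^sup>2 * c * x = 2 * \<sigma> * x * l * r\<^sup>2 + fx * r\<^sup>2"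
    unfolding lL L_def by (simp add: algebra_simps)
  show ?thesis
    unfolding J0[symmetric] Jy using arg_cong[OF J1, of "\<lambda>z. z * J1"]
    by (simp add: algebra_simps)
qed

lemma bessel_moment_solves_pde:
  fixes \<sigma> a B C \<mu> \<nu> :: real
  assumes \<sigma>: "\<sigma> > 0" and a: "a > 0" and g: "continuous_on {\<alpha>..\<beta>} g" and \<nu>: "\<nu> \<ge> 0"
    and diff: "\<And>x. x > 0 \<Longrightarrow> f differentiable at x"
    and ric: "\<And>x. x > 0 \<Longrightarrow> \<sigma> * x * deriv f x - \<sigma> * f x + 1/2 * (f x)\<^sup>2
          = 1/2 * (4 * \<sigma>\<^sup>2 * a\<^sup>2) * x\<^sup>2 + B * x + C"
    and F: "\<And>x. x > 0 \<Longrightarrow> (F has_real_derivative f x / x) (at x)"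
    and \<nu>2: "\<sigma>\<^sup>2 * \<nu>\<^sup>2 = 2 * C + 4 * \<mu> * \<sigma> + \<sigma>\<^sup>2"
    and u: "\<And>t x. t > 0 \<Longrightarrow> x > 0 \<Longrightarrow> u t x =
      exp (- F x / (2 * \<sigma>) - B * t / (2 * \<sigma>) + (\<nu> + 1) * ln (kcsch \<sigma> a t) + (\<nu> + 1) / 2 * ln x - kcoth \<sigma> a t * x)
      * bessel_moment \<alpha> \<beta> g \<nu> (kcoth \<sigma> a t) ((kcsch \<sigma> a t)\<^sup>2 * x)"
  shows "solves_pde \<sigma> f \<mu> u"
proof -
  define c where "c = kcoth \<sigma> a"
  define r where "r = kcsch \<sigma> a"
  define \<Theta> where "\<Theta> t x = - F x / (2 * \<sigma>) - B * t / (2 * \<sigma>) + (\<nu> + 1) * ln (r t) + (\<nu> + 1) / 2 * ln x - c t * x" for t x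
  define J0 where "J0 t x = bessel_moment \<alpha> \<beta> g \<nu> (c t) ((r t)\<^sup>2 * x)" for t x
  \<comment> \<open>\<open>Jy\<close> comes from differentiating the exponential, \<open>J1\<close>
    and \<open>J2\<close> from differentiating the series once and twice; every derivative brings a
    factor y.\<close>
  define Jy where "Jy t x = bessel_moment \<alpha> \<beta> (\<lambda>y. y * g y) \<nu> (c t) ((r t)\<^sup>2 * x)" for t x
  define J1 where "J1 t x = bessel_moment \<alpha> \<beta> (\<lambda>y. y * g y) (\<nu> + 1) (c t) ((r t)\<^sup>2 * x)" for t x
  define J2 where "J2 t x = bessel_moment \<alpha> \<beta> (\<lambda>y. y * (y * g y)) (\<nu> + 2) (c t) ((r t)\<^sup>2 * x)" for t x
  define l where "l t x = - f x / (2 * \<sigma> * x) + (\<nu> + 1) / (2 * x) - c t" for t x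
  define l' where "l' x = - deriv f x / (2 * \<sigma> * x) + f x / (2 * \<sigma> * x\<^sup>2) - (\<nu> + 1) / (2 * x\<^sup>2)" for x
  have rpos: "r t > 0" if "t > 0" for t
    unfolding r_def using kcsch_pos[OF \<sigma> a that] .
  have c': "(c has_real_derivative - (\<sigma> * (r t)\<^sup>2)) (at t)" if "t > 0" for t
    unfolding c_def r_def by (rule kcoth_deriv[OF \<sigma> a that])
  have r': "(r has_real_derivative - (\<sigma> * r t * c t)) (at t)" if "t > 0" for t
    unfolding c_def r_def by (rule kcsch_deriv[OF \<sigma> a that])
  have cont: "continuous_on {0<..} r" "continuous_on {0<..} c"
    unfolding c_def r_def by (rule continuous_on_kcsch[OF \<sigma> a] continuous_on_kcoth[OF \<sigma> a])+
  have yg: "continuous_on {\<alpha>..\<beta>} (\<lambda>y. y * g y)"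
    by (intro continuous_on_mult continuous_on_id g)
  have J0t: "((\<lambda>s. J0 s x) has_real_derivative
      (- 2 * \<sigma> * (r t)\<^sup>2 * c t * x) * J1 t x - (- (\<sigma> * (r t)\<^sup>2)) * Jy t x) (at t)"
    if "t > 0" "x > 0" for t x
    unfolding J0_def J1_def Jy_def
  proof (rule bessel_moment_deriv[OF g \<nu> that(1)])
    fix s :: real assume "s > 0"
    show "((\<lambda>s. (r s)\<^sup>2 * x) has_real_derivative - 2 * \<sigma> * (r s)\<^sup>2 * c s * x) (at s)"
      by (rule derivative_eq_intros r' \<open>s > 0\<close> refl)+ (simp add: power2_eq_square algebra_simps)
  qed (intro c' continuous_intros cont; assumption)+
  \<comment> \<open>The parameter of the Leibniz rule is now x: c is constant and q is linear with
    slope r^2.\<close>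
  have J0x: "(J0 t has_real_derivative (r t)\<^sup>2 * J1 t x) (at x)" if "t > 0" "x > 0" for t x
    using bessel_moment_deriv[OF g \<nu> that(2), of "\<lambda>_. c t" "\<lambda>_. 0" "\<lambda>x. (r t)\<^sup>2 * x" "\<lambda>_. (r t)\<^sup>2"]
    unfolding J0_def[abs_def] J1_def by (auto intro!: derivative_eq_intros)
  have J1x: "(J1 t has_real_derivative (r t)\<^sup>2 * J2 t x) (at x)" if "t > 0" "x > 0" for t x
    using bessel_moment_deriv[OF yg _ that(2), of "\<nu> + 1" "\<lambda>_. c t" "\<lambda>_. 0" "\<lambda>x. (r t)\<^sup>2 * x" "\<lambda>_. (r t)\<^sup>2"] \<nu>
    unfolding J2_def J1_def[abs_def] by (auto intro!: derivative_eq_intros simp: add.assoc)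
  have \<Theta>t: "((\<lambda>s. \<Theta> s x) has_real_derivative
      - B / (2 * \<sigma>) - (\<nu> + 1) * \<sigma> * c t + \<sigma> * (r t)\<^sup>2 * x) (at t)" if "t > 0" "x > 0" for t x
    unfolding \<Theta>_def using \<sigma> rpos[OF that(1)]
      by (auto intro!: derivative_eq_intros r'[OF that(1)] c'[OF that(1)])
  have \<Theta>x: "(\<Theta> t has_real_derivative l t x) (at x)" if "x > 0" for t x
    unfolding \<Theta>_def[abs_def] l_def using \<sigma> that
    by (auto intro!: derivative_eq_intros F[OF that] simp: field_simps)
  have lx: "(l t has_real_derivative l' x) (at x)" if "x > 0" for t x
  proof -
    have f': "(f has_real_derivative deriv f x) (at x)"
      using diff[OF that] by (simp add: DERIV_deriv_iff_real_differentiable)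
    have inv: "((\<lambda>x. 1 / x) has_real_derivative - (1 / x\<^sup>2)) (at x)"
      using that by (auto intro!: derivative_eq_intros simp: power2_eq_square)
    have "((\<lambda>x. - (f x * (1 / x)) / (2 * \<sigma>) + (\<nu> + 1) / 2 * (1 / x) - c t) has_real_derivative
       - (deriv f x * (1 / x) + - (1 / x\<^sup>2) * f x) / (2 * \<sigma>) + (\<nu> + 1) / 2 * - (1 / x\<^sup>2) - 0) (at x)"
      by (intro DERIV_diff DERIV_add DERIV_cdivide DERIV_minus DERIV_mult DERIV_cmult DERIV_const f' inv)
    moreover have "(\<lambda>x. - (f x * (1 / x)) / (2 * \<sigma>) + (\<nu> + 1) / 2 * (1 / x) - c t) = l t"
      by (simp add: l_def fun_eq_iff)
    moreover have "- (deriv f x * (1 / x) + - (1 / x\<^sup>2) * f x) / (2 * \<sigma>) + (\<nu> + 1) / 2 * - (1 / x\<^sup>2) - 0 = l' x"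
      using \<sigma> that by (simp add: l'_def diff_divide_distrib add_divide_distrib mult_ac)
    ultimately show ?thesis by simp
  qed
  show ?thesis
  proof (rule solves_pdeI)
    fix t x :: real assume tx: "t > 0" "x > 0"
    show "u t x = exp (\<Theta> t x) * J0 t x"
      unfolding u[OF tx] \<Theta>_def J0_def c_def r_def by simp
    show "((\<lambda>s. exp (\<Theta> s x) * J0 s x) has_real_derivative exp (\<Theta> t x) *
        ((- B / (2 * \<sigma>) - (\<nu> + 1) * \<sigma> * c t + \<sigma> * (r t)\<^sup>2 * x) * J0 t x
         + (\<sigma> * (r t)\<^sup>2 * Jy t x - 2 * \<sigma> * (r t)\<^sup>2 * c t * x * J1 t x))) (at t)"
      by (rule DERIV_cong[OF DERIV_mult[OF DERIV_chain2[OF DERIV_exp \<Theta>t[OF tx]] J0t[OF tx]]])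
         (simp add: algebra_simps)
    show "((\<lambda>x. exp (\<Theta> t x) * J0 t x) has_real_derivative
        exp (\<Theta> t x) * (l t x * J0 t x + (r t)\<^sup>2 * J1 t x)) (at x)"
      by (rule DERIV_cong[OF DERIV_mult[OF DERIV_chain2[OF DERIV_exp \<Theta>x[OF tx(2)]] J0x[OF tx]]])
         (simp add: algebra_simps)
    show "((\<lambda>x. exp (\<Theta> t x) * (l t x * J0 t x + (r t)\<^sup>2 * J1 t x)) has_real_derivative
        exp (\<Theta> t x) * ((l t x)\<^sup>2 * J0 t x + 2 * l t x * (r t)\<^sup>2 * J1 t x + l' x * J0 t x
          + (r t)\<^sup>2 * (r t)\<^sup>2 * J2 t x)) (at x)"
      by (rule DERIV_cong[OF DERIV_mult[OF DERIV_chain2[OF DERIV_exp \<Theta>x[OF tx(2)]]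
            DERIV_add[OF DERIV_mult[OF lx[OF tx(2)] J0x[OF tx]] DERIV_cmult[OF J1x[OF tx]]]]])
         (simp add: algebra_simps power2_eq_square)
    have "Jy t x = (r t)\<^sup>2 * x * J2 t x + (\<nu> + 1) * J1 t x"
      unfolding Jy_def J1_def J2_def by (rule bessel_moment_recurrence[OF g \<nu>])
    note id = pde_identity[OF \<sigma> tx(2) l_def[of t x] l'_def[of x] ric[OF tx(2)] _ \<nu>2 this, of "J0 t x"]
    have c2: "(c t)\<^sup>2 = a\<^sup>2 + (r t)\<^sup>2"
      unfolding c_def r_def by (rule kcoth_squared[OF \<sigma> a tx(1)])
    show "exp (\<Theta> t x) *
        ((- B / (2 * \<sigma>) - (\<nu> + 1) * \<sigma> * c t + \<sigma> * (r t)\<^sup>2 * x) * J0 t x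
         + (\<sigma> * (r t)\<^sup>2 * Jy t x - 2 * \<sigma> * (r t)\<^sup>2 * c t * x * J1 t x))
      = \<sigma> * x * (exp (\<Theta> t x) * ((l t x)\<^sup>2 * J0 t x + 2 * l t x * (r t)\<^sup>2 * J1 t x + l' x * J0 t x
          + (r t)\<^sup>2 * (r t)\<^sup>2 * J2 t x))
        + f x * (exp (\<Theta> t x) * (l t x * J0 t x + (r t)\<^sup>2 * J1 t x)) - \<mu> / x * (exp (\<Theta> t x) * J0 t x)"
      unfolding id[OF c2] by (simp only: distrib_left right_diff_distrib mult_ac)
  qed
qed

section \<open>Initial data and the kernel\<close>

text \<open>On the left is a prefactor times the Laplace integral with p = c + j and q = r^2 x,
  where r and c blow up as t tends to 0. The right side, in sinh and cosh alone, is regular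
  there.\<close>

lemma laplace_bessel_kernel:
  fixes \<sigma> a j x \<nu> :: real
  assumes \<sigma>: "\<sigma> > 0" and a: "a > 0" and j: "j \<ge> 0" and t: "t > 0"
  defines "S \<equiv> sinh (\<sigma> * a * t)" and "K \<equiv> cosh (\<sigma> * a * t)"
  shows "exp ((\<nu> + 1) * ln (kcsch \<sigma> a t) + (\<nu> + 1) / 2 * ln x - kcoth \<sigma> a t * x)
      * (exp ((kcsch \<sigma> a t)\<^sup>2 * x / (kcoth \<sigma> a t + j)) / (kcoth \<sigma> a t + j) powr (\<nu> + 1))
    = exp ((\<nu> + 1) / 2 * ln x) * (a / (a * K + j * S)) powr (\<nu> + 1)
      * exp (- (a * x * (a * S + j * K) / (a * K + j * S)))"
proof -
  define c where "c = kcoth \<sigma> a t"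
  define r where "r = kcsch \<sigma> a t"
  define D where "D = a * K + j * S"
  have S: "S > 0" unfolding S_def by (rule sinh_scaled_pos[OF \<sigma> a t])
  have K: "K > 0" unfolding K_def by simp
  have K2: "K\<^sup>2 = S\<^sup>2 + 1" unfolding K_def S_def by (rule cosh_square_eq)
  have D: "D > 0" unfolding D_def using S K a j by (simp add: add_pos_nonneg)
  have r: "r > 0" "r = a / S" unfolding r_def using kcsch_pos[OF \<sigma> a t] by (auto simp: kcsch_def S_def)
  have c: "c = a * K / S" unfolding c_def kcoth_def K_def S_def by simp
  have cj: "c + j = D / S" unfolding c D_def using S by (simp add: field_simps)
  have cj_pos: "c + j > 0" unfolding cj using S D by simp
  have "exp ((\<nu> + 1) * ln r) / (c + j) powr (\<nu> + 1) = r powr (\<nu> + 1) / (c + j) powr (\<nu> + 1)"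
    using r(1) by (simp add: powr_def)
  also have "\<dots> = (r / (c + j)) powr (\<nu> + 1)"
    using r(1) cj_pos by (simp add: powr_divide)
  also have "r / (c + j) = a / D" unfolding cj r(2) using S by simp
  finally have powr: "exp ((\<nu> + 1) * ln r) / (c + j) powr (\<nu> + 1) = (a / D) powr (\<nu> + 1)" .
  \<comment> \<open>Both terms on the left are singular at t = 0. By K^2 = S^2 + 1 the numerator
    over the common denominator S D contains a factor S, which removes the singularity.\<close>
  have "r\<^sup>2 / (c + j) - c = - (a * (a * S + j * K) / D)"
  proof -
    have "r\<^sup>2 / (c + j) - c = (a\<^sup>2 - a * K * D) / (S * D)"
      unfolding cj unfolding r(2) c using S D by (simp add: field_simps power2_eq_square)
    also have "a\<^sup>2 - a * K * D = - (a * (a * S + j * K)) * S"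
      using K2 unfolding D_def by algebra
    finally show ?thesis using S by simp
  qed
  hence ex: "r\<^sup>2 * x / (c + j) - c * x = - (a * x * (a * S + j * K) / D)"
    by (metis (no_types, opaque_lifting) left_diff_distrib minus_mult_left mult.assoc mult.commute
        times_divide_eq_left)
  have "exp ((\<nu> + 1) * ln r + (\<nu> + 1) / 2 * ln x - c * x) * (exp (r\<^sup>2 * x / (c + j)) / (c + j) powr (\<nu> + 1))
      = exp ((\<nu> + 1) / 2 * ln x) * (exp ((\<nu> + 1) * ln r) / (c + j) powr (\<nu> + 1))
        * exp (r\<^sup>2 * x / (c + j) - c * x)"
    by (simp add: exp_add exp_diff mult_ac)
  thus ?thesis unfolding powr ex c_def[symmetric] r_def[symmetric] D_def[symmetric] .
qed

text \<open>The product is continuous on the half-line and identically 0 off the support of the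
  datum; these two open sets cover the line, whatever h does outside the half-line.\<close>

lemma initial_datum_mult_continuous:
  assumes \<phi>: "initial_datum \<phi>" and h: "continuous_on {0<..} h"
  shows "continuous_on UNIV (\<lambda>y. \<phi> y * h y)"
proof -
  let ?S = "closure {y. \<phi> y \<noteq> 0}"
  have S: "closed ?S" "?S \<subseteq> {0<..}" "continuous_on UNIV \<phi>"
    using \<phi> by (auto simp: initial_datum_def)
  have "continuous_on ({0<..} \<union> - ?S) (\<lambda>y. \<phi> y * h y)"
  proof (rule continuous_on_open_Un)
    show "continuous_on {0<..} (\<lambda>y. \<phi> y * h y)"
      by (intro continuous_on_mult h continuous_on_subset[OF S(3)]) auto
    have "\<phi> y * h y = 0" if "y \<in> - ?S" for y
      using that closure_subset[of "{y. \<phi> y \<noteq> 0}"] by auto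
    thus "continuous_on (- ?S) (\<lambda>y. \<phi> y * h y)"
      by (subst continuous_on_cong[OF refl, where g = "\<lambda>_. 0"]) auto
  qed (use S in auto)
  moreover have "{0<..} \<union> - ?S = UNIV" using S(2) by auto
  ultimately show ?thesis by simp
qed

text \<open>A nonempty compact subset of the open half-line has a positive minimum. Integrals
  against the datum therefore avoid the possible singularities of F and of powers of y at 0.\<close>

lemma initial_datum_support:
  assumes "initial_datum \<phi>"
  obtains \<alpha> \<beta> where "0 < \<alpha>" "\<And>y. \<phi> y \<noteq> 0 \<Longrightarrow> y \<in> {\<alpha>..\<beta>}"
proof (cases "closure {y. \<phi> y \<noteq> 0} = {}")
  case True
  hence "\<phi> y = 0" for y using closure_subset[of "{y. \<phi> y \<noteq> 0}"] by auto
  thus ?thesis using that[of 1 1] by simp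
next
  case False
  let ?S = "closure {y. \<phi> y \<noteq> 0}"
  have S: "compact ?S" "?S \<subseteq> {0<..}" using assms by (auto simp: initial_datum_def)
  obtain \<alpha> where "\<alpha> \<in> ?S" "\<And>y. y \<in> ?S \<Longrightarrow> \<alpha> \<le> y"
    using compact_attains_inf[OF S(1) False] by blast
  moreover obtain \<beta> where "\<And>y. y \<in> ?S \<Longrightarrow> y \<le> \<beta>"
    using compact_attains_sup[OF S(1) False] by blast
  ultimately show ?thesis
    using that[of \<alpha> \<beta>] S(2) closure_subset[of "{y. \<phi> y \<noteq> 0}"] by auto
qed

text \<open>Half the Bessel argument is r sqrt (x y). Once all factors but the series are written as
  exponentials, the exponents combine: the prefactor r and the Bessel power give r^(\<nu> + 1), and
  the square root of x / y splits the powers of x and y unevenly.\<close>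

lemma kernel_factorization:
  fixes \<sigma> A B \<nu> t x y :: real
  assumes \<sigma>: "\<sigma> > 0" and A: "A > 0" and \<nu>: "\<nu> \<ge> 0" and pos: "t > 0" "x > 0" "y > 0"
    and a: "a = sqrt A / (2 * \<sigma>)"
  shows "sqrt A * exp ((F y - F x) / (2 * \<sigma>)) / (2 * \<sigma> * sinh (sqrt A * t / 2))
           * sqrt (x / y)
           * exp (- (B * t) / (2 * \<sigma>) - sqrt A * (x + y) / (2 * \<sigma> * tanh (sqrt A * t / 2)))
           * bessel_I \<nu> (sqrt (A * x * y) / (\<sigma> * sinh (sqrt A * t / 2)))
    = exp (- F x / (2 * \<sigma>) - B * t / (2 * \<sigma>))
      * exp ((\<nu> + 1) * ln (kcsch \<sigma> a t) + (\<nu> + 1) / 2 * ln x - kcoth \<sigma> a t * x)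
      * (exp (F y / (2 * \<sigma>)) * y powr ((\<nu> - 1) / 2) * exp (- (kcoth \<sigma> a t * y))
         * bessel_series \<nu> ((kcsch \<sigma> a t)\<^sup>2 * x * y))"
proof -
  define c where "c = kcoth \<sigma> a t"
  define r where "r = kcsch \<sigma> a t"
  define S where "S = sinh (sqrt A * t / 2)"
  have a0: "a > 0" unfolding a using \<sigma> A by simp
  have \<tau>: "\<sigma> * a * t = sqrt A * t / 2" unfolding a using \<sigma> by simp
  have S: "S > 0" unfolding S_def using A pos by simp
  have r: "r > 0" "sqrt A / (2 * \<sigma> * S) = r"
    unfolding r_def using kcsch_pos[OF \<sigma> a0 pos(1)] by (auto simp: kcsch_def \<tau> a S_def)
  have c: "sqrt A * (x + y) / (2 * \<sigma> * tanh (sqrt A * t / 2)) = c * x + c * y"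
    by (simp add: c_def kcoth_def \<tau> a tanh_def add_divide_distrib distrib_left distrib_right mult_ac)
  define z where "z = sqrt (A * x * y) / (\<sigma> * S)"
  have z2: "z / 2 = r * sqrt (x * y)"
    unfolding z_def r(2)[symmetric] using A pos by (simp add: real_sqrt_mult)
  have z: "z > 0" unfolding z_def using S \<sigma> A pos by simp
  have "bessel_I \<nu> z = (r * sqrt (x * y)) powr \<nu> * bessel_series \<nu> (r\<^sup>2 * x * y)"
    using bessel_I_eq_bessel_series[OF \<nu> z] pos unfolding z2 by (simp add: power_mult_distrib mult.assoc)
  also have "(r * sqrt (x * y)) powr \<nu> = exp (\<nu> * (ln r + (ln x + ln y) / 2))"
    using r(1) pos by (simp add: powr_def ln_mult ln_sqrt)
  finally have I: "bessel_I \<nu> z = exp (\<nu> * (ln r + (ln x + ln y) / 2)) * bessel_series \<nu> (r\<^sup>2 * x * y)" .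
  have sq: "sqrt (x / y) = exp ((ln x - ln y) / 2)"
  proof -
    have "sqrt (x / y) = exp (ln (sqrt (x / y)))" using pos by (subst exp_ln) auto
    also have "ln (sqrt (x / y)) = (ln x - ln y) / 2" using pos by (simp add: ln_sqrt ln_div)
    finally show ?thesis .
  qed
  have "sqrt A * exp ((F y - F x) / (2 * \<sigma>)) / (2 * \<sigma> * S) * sqrt (x / y)
           * exp (- (B * t) / (2 * \<sigma>) - (c * x + c * y)) * bessel_I \<nu> z
      = r * exp ((F y - F x) / (2 * \<sigma>)) * exp ((ln x - ln y) / 2)
           * exp (- (B * t) / (2 * \<sigma>) - (c * x + c * y))
           * (exp (\<nu> * (ln r + (ln x + ln y) / 2)) * bessel_series \<nu> (r\<^sup>2 * x * y))"
    unfolding I sq r(2)[symmetric] by simp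
  also have "r = exp (ln r)" using r(1) by simp
  also have "exp (ln r) * exp ((F y - F x) / (2 * \<sigma>)) * exp ((ln x - ln y) / 2)
           * exp (- (B * t) / (2 * \<sigma>) - (c * x + c * y))
           * (exp (\<nu> * (ln (exp (ln r)) + (ln x + ln y) / 2)) * bessel_series \<nu> ((exp (ln r))\<^sup>2 * x * y))
     = exp (ln r + (F y - F x) / (2 * \<sigma>) + (ln x - ln y) / 2
           + (- (B * t) / (2 * \<sigma>) - (c * x + c * y)) + \<nu> * (ln r + (ln x + ln y) / 2))
       * bessel_series \<nu> (r\<^sup>2 * x * y)"
    using r(1) by (simp add: exp_add)
  also have "ln r + (F y - F x) / (2 * \<sigma>) + (ln x - ln y) / 2
           + (- (B * t) / (2 * \<sigma>) - (c * x + c * y)) + \<nu> * (ln r + (ln x + ln y) / 2)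
     = (- F x / (2 * \<sigma>) - B * t / (2 * \<sigma>)) + ((\<nu> + 1) * ln r + (\<nu> + 1) / 2 * ln x - c * x)
       + F y / (2 * \<sigma>) + (\<nu> - 1) / 2 * ln y + - (c * y)"
    using \<sigma> by (simp add: field_simps)
  also have "exp \<dots> * bessel_series \<nu> (r\<^sup>2 * x * y)
     = exp (- F x / (2 * \<sigma>) - B * t / (2 * \<sigma>)) * exp ((\<nu> + 1) * ln r + (\<nu> + 1) / 2 * ln x - c * x)
      * (exp (F y / (2 * \<sigma>)) * y powr ((\<nu> - 1) / 2) * exp (- (c * y))
         * bessel_series \<nu> (r\<^sup>2 * x * y))"
    using pos by (simp only: exp_add powr_def) simp
  finally show ?thesis
    unfolding c_def[symmetric] r_def[symmetric] c z_def S_def[symmetric] .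
qed

text \<open>In the regular form the limit follows from sinh tending to 0 and cosh to 1. It is the
  transform of a point mass at x of weight x^((\<nu> + 1)/2), taken jointly in time and space as the
  initial condition demands.\<close>

lemma tendsto_laplace_bessel_kernel:
  fixes \<sigma> a j x \<nu> :: real
  assumes \<sigma>: "\<sigma> > 0" and a: "a > 0" and j: "j \<ge> 0" and x: "x > 0"
  shows "((\<lambda>(t, \<xi>). exp ((\<nu> + 1) * ln (kcsch \<sigma> a t) + (\<nu> + 1) / 2 * ln \<xi> - kcoth \<sigma> a t * \<xi>)
      * (exp ((kcsch \<sigma> a t)\<^sup>2 * \<xi> / (kcoth \<sigma> a t + j)) / (kcoth \<sigma> a t + j) powr (\<nu> + 1)))
    \<longlongrightarrow> exp ((\<nu> + 1) / 2 * ln x) * exp (- (j * x))) (at (0, x) within {0<..} \<times> {0<..})"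
proof -
  let ?\<F> = "at (0, x) within {0<..} \<times> {0::real<..}"
  define G where "G z = exp ((\<nu> + 1) / 2 * ln (snd z))
      * (a / (a * cosh (\<sigma> * a * fst z) + j * sinh (\<sigma> * a * fst z))) powr (\<nu> + 1)
      * exp (- (a * snd z * (a * sinh (\<sigma> * a * fst z) + j * cosh (\<sigma> * a * fst z))
               / (a * cosh (\<sigma> * a * fst z) + j * sinh (\<sigma> * a * fst z))))" for z :: "real \<times> real"
  have G: "G (t, \<xi>) = exp ((\<nu> + 1) * ln (kcsch \<sigma> a t) + (\<nu> + 1) / 2 * ln \<xi> - kcoth \<sigma> a t * \<xi>)
      * (exp ((kcsch \<sigma> a t)\<^sup>2 * \<xi> / (kcoth \<sigma> a t + j)) / (kcoth \<sigma> a t + j) powr (\<nu> + 1))"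
    if "t > 0" for t \<xi>
    unfolding G_def fst_conv snd_conv by (rule laplace_bessel_kernel[OF \<sigma> a j that, symmetric])
  have fst: "((\<lambda>z. fst z) \<longlongrightarrow> 0) ?\<F>" and snd: "((\<lambda>z. snd z) \<longlongrightarrow> x) ?\<F>"
    using tendsto_fst[OF tendsto_ident_at, of "(0, x)" "{0<..} \<times> {0<..}"]
      tendsto_snd[OF tendsto_ident_at, of "(0, x)" "{0<..} \<times> {0<..}"] by simp_all
  have \<tau>: "((\<lambda>z. \<sigma> * a * fst z) \<longlongrightarrow> 0) ?\<F>"
    using tendsto_mult_left[OF fst, of "\<sigma> * a"] by simp
  have S: "((\<lambda>z. sinh (\<sigma> * a * fst z)) \<longlongrightarrow> 0) ?\<F>" and K: "((\<lambda>z. cosh (\<sigma> * a * fst z)) \<longlongrightarrow> 1) ?\<F>"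
    using tendsto_sinh[OF \<tau>] tendsto_cosh[OF \<tau>] by simp_all
  have "(G \<longlongrightarrow> exp ((\<nu> + 1) / 2 * ln x) * (a / (a * 1 + j * 0)) powr (\<nu> + 1)
      * exp (- (a * x * (a * 0 + j * 1) / (a * 1 + j * 0)))) ?\<F>"
    unfolding G_def using a x by (intro tendsto_intros S K snd) auto
  hence "(G \<longlongrightarrow> exp ((\<nu> + 1) / 2 * ln x) * exp (- (j * x))) ?\<F>"
    using a by (simp add: mult.commute)
  moreover have "\<forall>\<^sub>F z in ?\<F>. G z = (case z of (t, \<xi>) \<Rightarrow>
      exp ((\<nu> + 1) * ln (kcsch \<sigma> a t) + (\<nu> + 1) / 2 * ln \<xi> - kcoth \<sigma> a t * \<xi>)
      * (exp ((kcsch \<sigma> a t)\<^sup>2 * \<xi> / (kcoth \<sigma> a t + j)) / (kcoth \<sigma> a t + j) powr (\<nu> + 1)))"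
    unfolding eventually_at_filter by (rule always_eventually) (auto simp: G)
  ultimately show ?thesis
    by (rule Lim_transform_eventually)
qed

section \<open>The equation and the initial condition combined for the kernel\<close>

theorem theorem5p7:
  fixes \<sigma> A B C \<mu> \<nu> :: real and f F :: "real \<Rightarrow> real"
  assumes "\<sigma> > 0" and "A > 0" and "\<mu> \<ge> 0"
    and "\<And>x. x > 0 \<Longrightarrow> f differentiable at x"
    and "\<And>x. x > 0 \<Longrightarrow>
           \<sigma> * x * deriv f x - \<sigma> * f x + 1/2 * (f x)\<^sup>2 = 1/2 * A * x\<^sup>2 + B * x + C"
    and "\<And>x. x > 0 \<Longrightarrow> (F has_real_derivative f x / x) (at x)"
    and "\<nu> = sqrt (2 * C + 4 * \<mu> * \<sigma> + \<sigma>\<^sup>2) / \<sigma>"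
  shows "\<exists>C1 C2 :: real \<Rightarrow> real. fundamental_solution \<sigma> f \<mu> (\<lambda>t x y.
           sqrt A * exp ((F y - F x) / (2 * \<sigma>)) / (2 * \<sigma> * sinh (sqrt A * t / 2))
           * sqrt (x / y)
           * exp (- (B * t) / (2 * \<sigma>) - sqrt A * (x + y) / (2 * \<sigma> * tanh (sqrt A * t / 2)))
           * (C1 y * bessel_I \<nu> (sqrt (A * x * y) / (\<sigma> * sinh (sqrt A * t / 2)))
              + C2 y * bessel_I_minus \<nu> (sqrt (A * x * y) / (\<sigma> * sinh (sqrt A * t / 2)))))"
proof -
  note \<sigma> = assms(1) and A = assms(2) and F = assms(6)
  define a where "a = sqrt A / (2 * \<sigma>)"
  have a: "a > 0" unfolding a_def using \<sigma> A by simp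
  have A_eq: "4 * \<sigma>\<^sup>2 * a\<^sup>2 = A"
    unfolding a_def using \<sigma> A by (simp add: power_divide power_mult_distrib)
  \<comment> \<open>A nonnegative radicand makes \<nu> nonnegative and gives \<nu>^2 its intended
    value; a negative one would yield a negative \<open>sqrt\<close>.\<close>
  have radicand: "2 * C + 4 * \<mu> * \<sigma> + \<sigma>\<^sup>2 \<ge> 0"
    using riccati_radicand_nonneg[OF assms(1,4,5)] mult_nonneg_nonneg[OF assms(3) less_imp_le[OF \<sigma>]]
    by linarith
  have \<nu>: "\<nu> \<ge> 0" unfolding assms(7) using \<sigma> radicand by simp
  have \<nu>2: "\<sigma>\<^sup>2 * \<nu>\<^sup>2 = 2 * C + 4 * \<mu> * \<sigma> + \<sigma>\<^sup>2"
    unfolding assms(7) using \<sigma> radicand by (simp add: power_divide)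
  define c where "c = kcoth \<sigma> a"
  define r where "r = kcsch \<sigma> a"
  have c_pos: "c t > 0" if "t > 0" for t unfolding c_def by (rule kcoth_pos[OF \<sigma> a that])
  define p where "p t x y = sqrt A * exp ((F y - F x) / (2 * \<sigma>)) / (2 * \<sigma> * sinh (sqrt A * t / 2))
           * sqrt (x / y)
           * exp (- (B * t) / (2 * \<sigma>) - sqrt A * (x + y) / (2 * \<sigma> * tanh (sqrt A * t / 2)))
           * bessel_I \<nu> (sqrt (A * x * y) / (\<sigma> * sinh (sqrt A * t / 2)))" for t x y
  define E where "E t x = exp (- F x / (2 * \<sigma>) - B * t / (2 * \<sigma>))" for t x
  define K where "K t x = exp ((\<nu> + 1) * ln (r t) + (\<nu> + 1) / 2 * ln x - c t * x)" for t x
  \<comment> \<open>The exponent is left free because the y-dependence is split in two ways, one for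
    the equation and one for the initial condition.\<close>
  define h where "h e y = exp (F y / (2 * \<sigma>)) * y powr e" for e y :: real
  have h: "continuous_on {0<..} (h e)" for e
    unfolding h_def
    by (intro continuous_at_imp_continuous_on ballI continuous_intros DERIV_isCont[OF F])
       (use \<sigma> in auto)
  have p: "p t x y = E t x * K t x * (h ((\<nu> - 1) / 2) y * exp (- (c t * y)) * bessel_series \<nu> ((r t)\<^sup>2 * x * y))"
    if "t > 0" "x > 0" "y > 0" for t x y
    unfolding p_def E_def K_def h_def c_def r_def
    by (rule kernel_factorization[OF \<sigma> A \<nu> that a_def])
  have "fundamental_solution \<sigma> f \<mu> p"
    unfolding fundamental_solution_def Let_def
  proof (intro allI impI conjI)
    fix \<phi> assume \<phi>: "initial_datum \<phi>"
    obtain \<alpha> \<beta> where \<alpha>: "0 < \<alpha>" and supp: "\<And>y. \<phi> y \<noteq> 0 \<Longrightarrow> y \<in> {\<alpha>..\<beta>}"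
      using initial_datum_support[OF \<phi>] by metis
    \<comment> \<open>\<open>g\<close> absorbs the whole power of y, as suits the moments.
      \<open>\<psi>\<close> leaves y^\<nu> to the kernel, which is the weight with an explicit
      Laplace transform; indeed (\<nu> - 1)/2 = -(\<nu> + 1)/2 + \<nu>.\<close>
    define g where "g y = \<phi> y * h ((\<nu> - 1) / 2) y" for y
    define \<psi> where "\<psi> y = \<phi> y * h (- (\<nu> + 1) / 2) y" for y
    have g: "continuous_on UNIV g" and \<psi>: "continuous_on UNIV \<psi>"
      unfolding g_def \<psi>_def by (intro initial_datum_mult_continuous[OF \<phi> h])+
    define u where "u t x = (LINT y:{0..}|lborel. \<phi> y * p t x y)" for t x
    \<comment> \<open>Where the datum is nonzero, y lies in the interval and is positive, so the
      factorization applies; elsewhere both sides are 0.\<close>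
    have p_g: "indicator {0..} y *\<^sub>R (\<phi> y * p t x y) = indicator {\<alpha>..\<beta>} y *\<^sub>R
        (E t x * K t x * (g y * exp (- (c t * y)) * bessel_series \<nu> ((r t)\<^sup>2 * x * y)))"
      if "t > 0" "x > 0" for t x y
    proof (cases "\<phi> y = 0")
      case False
      hence "y \<in> {\<alpha>..\<beta>}" "y > 0" using supp \<alpha> by force+
      thus ?thesis using p[OF that, of y] by (simp add: g_def mult_ac)
    qed (simp add: g_def)
    have int_g: "set_integrable lborel {\<alpha>..\<beta>}
        (\<lambda>y. E t x * K t x * (g y * exp (- (c t * y)) * bessel_series \<nu> ((r t)\<^sup>2 * x * y)))" for t x
      by (intro borel_integrable_atLeastAtMost' continuous_on_mult continuous_on_const
            continuous_on_bessel_series[OF \<nu>] continuous_on_exp continuous_on_minus continuous_on_id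
            continuous_on_subset[OF g]) auto
    show "set_integrable lborel {0..} (\<lambda>y. \<phi> y * p t x y)" if "t > 0" "x > 0" for t x
      using int_g[of t x] unfolding set_integrable_def p_g[OF that] .
    have u_moment: "u t x = E t x * K t x * bessel_moment \<alpha> \<beta> g \<nu> (c t) ((r t)\<^sup>2 * x)"
      if "t > 0" "x > 0" for t x
    proof -
      have "u t x = (LINT y:{\<alpha>..\<beta>}|lborel.
          E t x * K t x * (g y * exp (- (c t * y)) * bessel_series \<nu> ((r t)\<^sup>2 * x * y)))"
        unfolding u_def set_lebesgue_integral_def p_g[OF that] ..
      also have "\<dots> = integral {\<alpha>..\<beta>} (\<lambda>y.
          E t x * K t x * (g y * exp (- (c t * y)) * bessel_series \<nu> ((r t)\<^sup>2 * x * y)))"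
        by (rule set_borel_integral_eq_integral(2)[OF int_g])
      finally show ?thesis unfolding bessel_moment_def by simp
    qed
    have "solves_pde \<sigma> f \<mu> u"
    proof (rule bessel_moment_solves_pde[OF \<sigma> a _ \<nu> assms(4) _ F \<nu>2])
      show "continuous_on {\<alpha>..\<beta>} g" using g by (rule continuous_on_subset) simp
      show "\<sigma> * x * deriv f x - \<sigma> * f x + 1/2 * (f x)\<^sup>2
          = 1/2 * (4 * \<sigma>\<^sup>2 * a\<^sup>2) * x\<^sup>2 + B * x + C" if "x > 0" for x
        unfolding A_eq by (rule assms(5)[OF that])
      show "u t x = exp (- F x / (2 * \<sigma>) - B * t / (2 * \<sigma>) + (\<nu> + 1) * ln (kcsch \<sigma> a t)
            + (\<nu> + 1) / 2 * ln x - kcoth \<sigma> a t * x)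
          * bessel_moment \<alpha> \<beta> g \<nu> (kcoth \<sigma> a t) ((kcsch \<sigma> a t)\<^sup>2 * x)" if "t > 0" "x > 0" for t x
        unfolding u_moment[OF that] E_def K_def exp_add[symmetric] c_def r_def
        by (simp add: add_diff_eq add.assoc)
    qed
    thus "solves_pde \<sigma> f \<mu> (\<lambda>t x. LINT y:{0..}|lborel. \<phi> y * p t x y)"
      unfolding u_def[abs_def] .
    fix x :: real assume x: "x > 0"
    let ?\<F> = "at (0, x) within {0<..} \<times> {0::real<..}"
    have pos: "\<forall>\<^sub>F z in ?\<F>. fst z > 0 \<and> snd z > 0"
      unfolding eventually_at_filter by (rule always_eventually) auto
    \<comment> \<open>The nonnegative kernel for the Korovkin argument, with the factor
      \<open>E\<close> and the function of y in \<open>\<psi>\<close> removed; \<open>L j\<close> is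
      its Laplace transform at j.\<close>
    define k where "k z y = indicator {0..} y * (K (fst z) (snd z) *
        (y powr \<nu> * exp (- (c (fst z) * y)) * bessel_series \<nu> ((r (fst z))\<^sup>2 * snd z * y)))"
      for z :: "real \<times> real" and y :: real
    define L where "L j z = K (fst z) (snd z) *
        (exp ((r (fst z))\<^sup>2 * snd z / (c (fst z) + j)) / (c (fst z) + j) powr (\<nu> + 1))"
      for j and z :: "real \<times> real"
    have "((\<lambda>z. \<integral>y. \<psi> y * k z y \<partial>lborel) \<longlongrightarrow> \<psi> x * exp ((\<nu> + 1) / 2 * ln x)) ?\<F>"
    proof -
      have "bounded (\<psi> ` {\<alpha>..\<beta>})"
        by (intro compact_imp_bounded compact_continuous_image continuous_on_subset[OF \<psi>]) auto
      then obtain N where N0: "N > 0" "\<forall>z\<in>\<psi> ` {\<alpha>..\<beta>}. norm z \<le> N"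
        unfolding bounded_pos by blast
      hence N: "\<And>y. y \<in> {\<alpha>..\<beta>} \<Longrightarrow> \<bar>\<psi> y\<bar> \<le> N" by simp
      have bdd: "\<bar>\<psi> y\<bar> \<le> N" for y
      proof (cases "\<phi> y = 0")
        case False
        thus ?thesis using N supp by blast
      qed (use N0(1) in \<open>simp add: \<psi>_def\<close>)
      have cont: "isCont \<psi> x" using \<psi> by (simp add: continuous_on_eq_continuous_at)
      show ?thesis
      proof (rule korovkin_exp[OF cont bdd])
        show "\<psi> \<in> borel_measurable borel" by (rule borel_measurable_continuous_onI[OF \<psi>])
        show "\<forall>\<^sub>F z in ?\<F>. \<forall>y. k z y \<ge> 0"
          using pos
        proof eventually_elim
          case (elim z)
          show ?case
            using elim \<nu> by (auto simp: k_def K_def indicator_def intro!: mult_nonneg_nonneg bessel_series_nonneg)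
        qed
        fix j :: real assume j: "j \<ge> 0"
        show "\<forall>\<^sub>F z in ?\<F>. has_bochner_integral lborel (\<lambda>y. k z y * exp (- (j * y))) (L j z)"
          using pos
        proof eventually_elim
          case (elim z)
          define t \<xi> where "t = fst z" and "\<xi> = snd z"
          \<comment> \<open>The test function exp (-j y) only shifts the decay rate from c to c + j,
            so the termwise integral applies with p = c + j.\<close>
          have "c t + j > 0" "(r t)\<^sup>2 * \<xi> \<ge> 0"
            using elim c_pos[of t] j by (auto simp: t_def \<xi>_def intro: add_pos_nonneg)
          from has_bochner_integral_mult_right[OF has_bochner_integral_bessel_series[OF \<nu> this], of "K t \<xi>"]
          have "has_bochner_integral lborel (\<lambda>y. K t \<xi> * (indicator {0..} y *
              (y powr \<nu> * exp (- ((c t + j) * y)) * bessel_series \<nu> ((r t)\<^sup>2 * \<xi> * y)))) (L j z)"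
            by (simp add: L_def t_def \<xi>_def)
          moreover have "K t \<xi> * (indicator {0..} y *
              (y powr \<nu> * exp (- ((c t + j) * y)) * bessel_series \<nu> ((r t)\<^sup>2 * \<xi> * y)))
              = k z y * exp (- (j * y))" for y
          proof -
            have "exp (- ((c t + j) * y)) = exp (- (c t * y)) * exp (- (j * y))"
              by (simp add: distrib_right flip: exp_add)
            thus ?thesis by (simp add: k_def t_def \<xi>_def)
          qed
          ultimately show ?case by simp
        qed
        show "(L j \<longlongrightarrow> exp ((\<nu> + 1) / 2 * ln x) * exp (- (j * x))) ?\<F>"
          using tendsto_laplace_bessel_kernel[OF \<sigma> a j x, of \<nu>]
          unfolding L_def[abs_def] K_def c_def r_def case_prod_unfold .
      qed
    qed
    moreover have "((\<lambda>z. E (fst z) (snd z)) \<longlongrightarrow> E 0 x) ?\<F>"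
    proof -
      have fst: "((\<lambda>z. fst z) \<longlongrightarrow> 0) ?\<F>" and snd: "((\<lambda>z. snd z) \<longlongrightarrow> x) ?\<F>"
        using tendsto_fst[OF tendsto_ident_at, of "(0, x)" "{0<..} \<times> {0<..}"]
          tendsto_snd[OF tendsto_ident_at, of "(0, x)" "{0<..} \<times> {0<..}"] by simp_all
      have "((\<lambda>z. F (snd z)) \<longlongrightarrow> F x) ?\<F>"
        by (rule isCont_tendsto_compose[OF DERIV_isCont[OF F[OF x]] snd])
      thus ?thesis unfolding E_def using \<sigma> by (intro tendsto_intros fst) auto
    qed
    ultimately have "((\<lambda>z. E (fst z) (snd z) * (\<integral>y. \<psi> y * k z y \<partial>lborel))
        \<longlongrightarrow> E 0 x * (\<psi> x * exp ((\<nu> + 1) / 2 * ln x))) ?\<F>"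
      by (intro tendsto_mult)
    \<comment> \<open>The limiting weight x^((\<nu> + 1)/2) and exp (-F x / (2 \<sigma>)) are the
      reciprocals of the two factors that \<open>\<psi>\<close> attaches to the datum.\<close>
    moreover have "E 0 x * (\<psi> x * exp ((\<nu> + 1) / 2 * ln x)) = \<phi> x"
    proof -
      have "E 0 x * (\<psi> x * exp ((\<nu> + 1) / 2 * ln x)) = \<phi> x *
          exp (- F x / (2 * \<sigma>) + F x / (2 * \<sigma>) + - (\<nu> + 1) / 2 * ln x + (\<nu> + 1) / 2 * ln x)"
        unfolding exp_add E_def \<psi>_def h_def powr_def using x by simp
      also have "- F x / (2 * \<sigma>) + F x / (2 * \<sigma>) + - (\<nu> + 1) / 2 * ln x + (\<nu> + 1) / 2 * ln x = 0"
        by (simp add: field_simps)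
      finally show ?thesis by simp
    qed
    moreover have "\<forall>\<^sub>F z in ?\<F>. E (fst z) (snd z) * (\<integral>y. \<psi> y * k z y \<partial>lborel) = (case z of (t, \<xi>) \<Rightarrow> u t \<xi>)"
      using pos
    proof eventually_elim
      case (elim z)
      define t \<xi> where "t = fst z" and "\<xi> = snd z"
      have t: "t > 0" "\<xi> > 0" using elim by (auto simp: t_def \<xi>_def)
      have "indicator {0..} y *\<^sub>R (\<phi> y * p t \<xi> y) = E t \<xi> * (\<psi> y * k z y)" for y
      proof (cases "\<phi> y = 0")
        case False
        hence y: "y > 0" using supp \<alpha> by force
        have "(\<nu> - 1) / 2 = - (\<nu> + 1) / 2 + \<nu>" by (simp add: field_simps)
        hence "h ((\<nu> - 1) / 2) y = h (- (\<nu> + 1) / 2) y * y powr \<nu>"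
          unfolding h_def by (simp only: powr_add mult.assoc)
        thus ?thesis
          using y p[OF t y] by (simp add: \<psi>_def k_def t_def[symmetric] \<xi>_def[symmetric])
      qed (simp add: \<psi>_def)
      thus ?case
        by (simp add: u_def set_lebesgue_integral_def case_prod_unfold t_def[symmetric] \<xi>_def[symmetric]
            del: real_scaleR_def)
    qed
    ultimately have "((\<lambda>(t, \<xi>). u t \<xi>) \<longlongrightarrow> \<phi> x) ?\<F>"
      using Lim_transform_eventually by fastforce
    thus "((\<lambda>(t, \<xi>). LINT y:{0..}|lborel. \<phi> y * p t \<xi> y) \<longlongrightarrow> \<phi> x) ?\<F>"
      unfolding u_def .
  qed
  thus ?thesis
    unfolding p_def[abs_def]
    by (intro exI[of _ "\<lambda>_. 1"] exI[of _ "\<lambda>_. 0"]) simp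
qed

end
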